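(* Let $K$ be a hermitian $2\times2$-matrix and $Y$ a linear subspace of $\mathbb C^2$; let $P_Y,P_{Y^\perp}$ be the orthogonal projections of $\mathbb C^2$ onto $Y$, $Y^\perp$, viewed as $2\times2$-matrices. For $\lambda\in\mathbb R\setminus\{0\}$ set $$\mathcal M(\lambda)=\begin{pmatrix}\frac1\lambda&0\\0&\frac1{\lambda^2}\end{pmatrix},\quad \mathcal B(\lambda)=\begin{pmatrix}\sin\lambda&1-\cos\lambda\\1-\cos\lambda&\lambda-\sin\lambda\end{pmatrix},\quad \mathcal C(\lambda)=\begin{pmatrix}\lambda\sin\lambda-\cos\lambda&\lambda(1-\cos\lambda)-\sin\lambda\\ \cos\lambda-1&\sin\lambda\end{pmatrix}.$$ Then, for $\lambda\in\mathbb R\setminus\{0\}$, $\lambda^2$ is an eigenvalue of $A_{Y,K}$ (see context) if and only if the $4\times2$-matrix $$\begin{pmatrix}P_{Y^\perp}\mathcal M(\lambda)\mathcal B(\lambda)\\ P_Y\big(K\mathcal M(\lambda)\mathcal B(\lambda)-\mathcal C(\lambda)\big)\end{pmatrix}$$ has rank $0$ or $1$.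
   Context: All spaces are complex; inner products are linear in the first argument. $H^1(T):=\{u\in H^1(0,1):u(0)=u(1)\}$, $H^{-1}(T)$ is its dual, with $f\in L^2(0,1)$ identified with $\varphi\mapsto\int_0^1 f\varphi\,dx$. Put $\mu_0(\varphi):=\langle\varphi,1\rangle$ for $\varphi\in H^{-1}(T)$ and $\mu_1(f):=\int_0^1(1-x)f(x)\,dx$ for $f\in L^2(0,1)$; $\Gamma_1 f:=(\mu_0(f),\mu_1(f))^\top$. The operator $P:H^{-1}(T)\to L^2(0,1)$ (bounded) is defined by $\langle Pu,\varphi\rangle=\langle u,J\varphi\rangle$, $J\varphi(x):=\int_x^1\big(\varphi(y)-\int_0^1\varphi(z)dz\big)dy$. $H^{-1}(T)$ is equipped with the (equivalent) inner product $(f|g)_{H^{-1}(T)}:=(Pf|Pg)_{L^2}+\mu_0(f)\overline{\mu_0(g)}$. $H:=\{w\in H^{-1}(T):\mu_0(w)=0\}$ with the restricted inner product. For a subspace $Y$ of $\mathbb C^2$: $V_Y:=\{f\in L^2(0,1):\Gamma_1 f\in Y\}$ with the $L^2$ inner product; $H_Y:=H$ if $Y=\{0\}^2$ or $Y=\{0\}\times\mathbb C$, and $H_Y:=H^{-1}(T)$ otherwise ($V_Y$ is dense in $H_Y$). For a $2\times2$-matrix $K$, $a_K(f,g):=(f|g)_{L^2}+(K\Gamma_1 f|\Gamma_1 g)_{\mathbb C^2}$, $f,g\in V_Y$. The associated operator is: $D(A_{Y,K}):=\{f\in V_Y:\exists g\in H_Y,\ a_K(f,h)=(g|h)_{H^{-1}(T)}\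 \forall h\in V_Y\}$, $A_{Y,K}f:=g$. *)

theory Defs
  imports "HOL-Analysis.Analysis"
begin

section \<open>Function spaces on the unit interval\<close>

abbreviation I01 :: "real measure" where
  "I01 \<equiv> restrict_space lborel {0<..<1}"

text \<open>
  Elements of \<open>L\<^sup>2(0,1)\<close> are represented by square-integrable functions; two of them are the
  same element iff they agree almost everywhere. Values outside \<open>(0,1)\<close> are irrelevant.
\<close>

definition L2 :: "(real \<Rightarrow> complex) set" where
  "L2 = {f. f \<in> borel_measurable I01 \<and> integrable I01 (\<lambda>x. (cmod (f x))\<^sup>2)}"

definition L2_inner :: "(real \<Rightarrow> complex) \<Rightarrow> (real \<Rightarrow> complex) \<Rightarrow> complex" where
  "L2_inner f g = (LINT x|I01. f x * cnj (g x))"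

text \<open>
  \<open>H1_deriv u v\<close>: on \<open>[0,1]\<close>, \<open>u\<close> is the (absolutely) continuous representative of an element of
  \<open>H\<^sup>1(0,1)\<close> with weak derivative \<open>v\<close>. Values of \<open>u\<close> outside \<open>[0,1]\<close> are unconstrained.
\<close>

definition H1_deriv :: "(real \<Rightarrow> complex) \<Rightarrow> (real \<Rightarrow> complex) \<Rightarrow> bool" where
  "H1_deriv u v \<longleftrightarrow> v \<in> L2 \<and> (\<forall>x\<in>{0..1}. u x = u 0 + (LINT y:{0..x}|I01. v y))"

definition H1T :: "(real \<Rightarrow> complex) set" where
  "H1T = {u. (\<exists>v. H1_deriv u v) \<and> u 0 = u 1}"

text \<open>
  The space \<open>H\<^sup>-\<^sup>1(T)\<close> of bounded linear (not antilinear) functionals on \<open>H\<^sup>1(T)\<close>, with respect to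
  the usual \<open>H\<^sup>1\<close> norm. Linearity together with the bound makes them insensitive to values
  of the argument outside \<open>[0,1]\<close>. Functionals are \<^const>\<open>undefined\<close> outside \<^term>\<open>H1T\<close>, so that
  equality of functionals is equality in HOL.
\<close>

definition Hm1T :: "((real \<Rightarrow> complex) \<Rightarrow> complex) set" where
  "Hm1T = {F \<in> extensional H1T.
     (\<forall>u\<in>H1T. \<forall>v\<in>H1T. F (\<lambda>x. u x + v x) = F u + F v) \<and>
     (\<forall>c. \<forall>u\<in>H1T. F (\<lambda>x. c * u x) = c * F u) \<and>
     (\<exists>C. \<forall>u v. u \<in> H1T \<longrightarrow> H1_deriv u v \<longrightarrow>
        cmod (F u) \<le> C * sqrt ((LINT x|I01. (cmod (u x))\<^sup>2) + (LINT x|I01. (cmod (v x))\<^sup>2)))}"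

definition Hm1_of :: "(real \<Rightarrow> complex) \<Rightarrow> (real \<Rightarrow> complex) \<Rightarrow> complex" where
  "Hm1_of f = (\<lambda>\<phi>\<in>H1T. LINT x|I01. f x * \<phi> x)"

definition Hm1_scale :: "complex \<Rightarrow> ((real \<Rightarrow> complex) \<Rightarrow> complex) \<Rightarrow> (real \<Rightarrow> complex) \<Rightarrow> complex" where
  "Hm1_scale c F = (\<lambda>\<phi>\<in>H1T. c * F \<phi>)"

definition mu0 :: "((real \<Rightarrow> complex) \<Rightarrow> complex) \<Rightarrow> complex" where
  "mu0 F = F (\<lambda>_. 1)"

definition mu1 :: "(real \<Rightarrow> complex) \<Rightarrow> complex" where
  "mu1 f = (LINT x|I01. complex_of_real (1 - x) * f x)"

definition Gamma1 :: "(real \<Rightarrow> complex) \<Rightarrow> complex^2" where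
  "Gamma1 f = vector [mu0 (Hm1_of f), mu1 f]"

definition J :: "(real \<Rightarrow> complex) \<Rightarrow> real \<Rightarrow> complex" where
  "J \<phi> x = (LINT y:{x..1}|I01. \<phi> y - (LINT z|I01. \<phi> z))"

text \<open>
  \<open>P F\<close> is a representative of the element of \<open>L\<^sup>2(0,1)\<close>, unique up to null sets, that the Riesz
  theorem attaches to the bounded functional \<open>\<phi> \<mapsto> F (J \<phi>)\<close>; only its almost-everywhere class
  matters below.
\<close>

definition P :: "((real \<Rightarrow> complex) \<Rightarrow> complex) \<Rightarrow> real \<Rightarrow> complex" where
  "P F = (SOME p. p \<in> L2 \<and> (\<forall>\<phi>\<in>L2. (LINT x|I01. p x * \<phi> x) = F (J \<phi>)))"

definition Hm1_inner ::
  "((real \<Rightarrow> complex) \<Rightarrow> complex) \<Rightarrow> ((real \<Rightarrow> complex) \<Rightarrow> complex) \<Rightarrow> complex" where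
  "Hm1_inner F G = L2_inner (P F) (P G) + mu0 F * cnj (mu0 G)"

section \<open>The space \<open>\<complex>\<^sup>2\<close>\<close>

definition cinner2 :: "complex^2 \<Rightarrow> complex^2 \<Rightarrow> complex" where
  "cinner2 v w = (\<Sum>i\<in>UNIV. v $ i * cnj (w $ i))"

definition hermitian2 :: "complex^2^2 \<Rightarrow> bool" where
  "hermitian2 K \<longleftrightarrow> (\<forall>i j. K $ i $ j = cnj (K $ j $ i))"

definition orth_compl :: "(complex^2) set \<Rightarrow> (complex^2) set" where
  "orth_compl Y = {v. \<forall>w\<in>Y. cinner2 v w = 0}"

definition orth_proj :: "(complex^2) set \<Rightarrow> complex^2^2" where
  "orth_proj Y = (THE Q. \<forall>v. Q *v v \<in> Y \<and> v - Q *v v \<in> orth_compl Y)"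

section \<open>The form and its associated operator\<close>

definition V :: "(complex^2) set \<Rightarrow> (real \<Rightarrow> complex) set" where
  "V Y = {f \<in> L2. Gamma1 f \<in> Y}"

definition HY :: "(complex^2) set \<Rightarrow> ((real \<Rightarrow> complex) \<Rightarrow> complex) set" where
  "HY Y = (if Y = {0} \<or> Y = {v. v $ 1 = 0} then {w \<in> Hm1T. mu0 w = 0} else Hm1T)"

definition form_a :: "complex^2^2 \<Rightarrow> (real \<Rightarrow> complex) \<Rightarrow> (real \<Rightarrow> complex) \<Rightarrow> complex" where
  "form_a K f g = L2_inner f g + cinner2 (K *v Gamma1 f) (Gamma1 g)"

text \<open>
  The associated operator is given by its graph: \<open>(f, g) \<in> op_A Y K\<close> means that \<open>f\<close> is in the domain
  and is mapped to \<open>g\<close>. As \<open>V Y\<close> is dense in \<open>HY Y\<close>, the relation is single-valued.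
\<close>

definition op_A ::
  "(complex^2) set \<Rightarrow> complex^2^2 \<Rightarrow> ((real \<Rightarrow> complex) \<times> ((real \<Rightarrow> complex) \<Rightarrow> complex)) set" where
  "op_A Y K = {(f, g). f \<in> V Y \<and> g \<in> HY Y \<and> (\<forall>h\<in>V Y. form_a K f h = Hm1_inner g (Hm1_of h))}"

text \<open>Eigenvectors must be nonzero as elements of \<open>L\<^sup>2(0,1)\<close>, i.e. not almost everywhere zero.\<close>

definition is_eigenvalue ::
  "((real \<Rightarrow> complex) \<times> ((real \<Rightarrow> complex) \<Rightarrow> complex)) set \<Rightarrow> complex \<Rightarrow> bool" where
  "is_eigenvalue A z \<longleftrightarrow>
     (\<exists>f. \<not> (AE x in I01. f x = 0) \<and> (f, Hm1_scale z (Hm1_of f)) \<in> A)"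

section \<open>The matrices of the characteristic equation\<close>

definition matM :: "real \<Rightarrow> complex^2^2" where
  "matM l = vector [vector [of_real (1 / l), 0], vector [0, of_real (1 / l\<^sup>2)]]"

definition matB :: "real \<Rightarrow> complex^2^2" where
  "matB l = vector
     [vector [of_real (sin l), of_real (1 - cos l)],
      vector [of_real (1 - cos l), of_real (l - sin l)]]"

definition matC :: "real \<Rightarrow> complex^2^2" where
  "matC l = vector
     [vector [of_real (l * sin l - cos l), of_real (l * (1 - cos l) - sin l)],
      vector [of_real (cos l - 1), of_real (sin l)]]"

definition stack :: "complex^2^2 \<Rightarrow> complex^2^2 \<Rightarrow> complex^2^4" where
  "stack A B = vector [A $ 1, A $ 2, B $ 1, B $ 2]"

end

theory Submission
  imports Defs
begin

text \<open>
  For \<open>f \<in> L\<^sup>2\<close> one has \<open>P f(x) = \<integral>\<^sub>0\<^sup>x f - \<mu>\<^sub>1(f)\<close>, and Fubini on a triangle turns \<open>(P f | P h)\<close> into \<open>(G f | h)\<close>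
  with \<open>G f(x) = \<integral>\<^sub>x\<^sup>1 P f\<close>. The eigenvalue equation says that \<open>r = f - \<lambda>\<^sup>2 G f\<close> satisfies
  \<open>(r | h) + (K \<Gamma>\<^sub>1 f - (\<lambda>\<^sup>2 \<mu>\<^sub>0(f), 0) | \<Gamma>\<^sub>1 h) = 0\<close> for all \<open>h\<close> with \<open>\<Gamma>\<^sub>1 h \<in> Y\<close>. Testing with
  \<open>\<Gamma>\<^sub>1 h = 0\<close> shows that \<open>r\<close> is affine, so \<open>f'' = -\<lambda>\<^sup>2 f\<close> and \<open>f = c\<^sub>1 cos(\<lambda>x) + c\<^sub>2 sin(\<lambda>x)\<close>. For such
  \<open>f\<close> one computes \<open>r(x) = f(1) + (f(0) - f(1)) (1 - x)\<close>, \<open>\<Gamma>\<^sub>1 f = M B c\<close> and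
  \<open>(f(1) - \<lambda>\<^sup>2 \<mu>\<^sub>0(f), f(0) - f(1)) = - C c\<close>. Since \<open>\<Gamma>\<^sub>1\<close> is onto, the equation becomes
  \<open>M B c \<in> Y\<close> and \<open>(K M B - C) c \<bottom> Y\<close>, that is, \<open>c\<close> lies in the kernel of the \<open>4 \<times> 2\<close> matrix.
\<close>

section \<open>Linear algebra\<close>

text \<open>A trivial kernel means a left inverse, hence rows that span everything, hence row rank
  equal to the number of columns. The rank cannot exceed that number, so a nontrivial kernel is
  strict inequality.\<close>

lemma exists_kernel_vector_iff_rank:
  fixes A :: "'a::field^'n^'m"
  shows "(\<exists>x. x \<noteq> 0 \<and> A *v x = 0) \<longleftrightarrow> rank A < CARD('n)"
proof -
  have le: "rank A \<le> CARD('n)"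
    using vec.dim_subset_UNIV[of "rows A"]
    by (simp add: row_rank_def_gen vec.dimension_def card_cart_basis)
  have "(\<forall>x. A *v x = 0 \<longrightarrow> x = 0) \<longleftrightarrow> vec.span (rows A) = UNIV"
    by (simp add: matrix_left_invertible_ker[symmetric] matrix_left_invertible_span_rows_gen)
  also have "\<dots> \<longleftrightarrow> rank A = CARD('n)"
    using vec.dim_eq_full[of "rows A"]
    by (simp add: row_rank_def_gen vec.dimension_def card_cart_basis)
  finally show ?thesis using le by (metis le_neq_implies_less less_irrefl)
qed

lemma vector_4 [simp]:
  "(vector [w,x,y,z] :: 'a::zero^4) $ 1 = w" "(vector [w,x,y,z] :: 'a::zero^4) $ 2 = x"
  "(vector [w,x,y,z] :: 'a::zero^4) $ 3 = y" "(vector [w,x,y,z] :: 'a::zero^4) $ 4 = z"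
  unfolding vector_def by simp_all

lemma stack_mult_eq_0_iff: "stack A B *v c = 0 \<longleftrightarrow> A *v c = 0 \<and> B *v c = 0"
  by (auto simp: stack_def vec_eq_iff forall_4 forall_2 matrix_vector_mult_def)

section \<open>The hermitian form on complex pairs and its orthogonal projections\<close>

lemma cinner2_2: "cinner2 v w = v $ 1 * cnj (w $ 1) + v $ 2 * cnj (w $ 2)"
  by (simp add: cinner2_def sum_2)

lemma cinner2_simps:
  "cinner2 (u + v) w = cinner2 u w + cinner2 v w"
  "cinner2 (u - v) w = cinner2 u w - cinner2 v w"
  "cinner2 (a *s v) w = a * cinner2 v w"
  "cinner2 w (u + v) = cinner2 w u + cinner2 w v"
  "cinner2 w (u - v) = cinner2 w u - cinner2 w v"
  "cinner2 w (a *s v) = cnj a * cinner2 w v"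
  by (simp_all add: cinner2_2 algebra_simps)

lemma cinner2_self_eq_0_iff: "cinner2 v v = 0 \<longleftrightarrow> v = 0"
proof
  assume "cinner2 v v = 0"
  then have "of_real ((cmod (v $ 1))\<^sup>2 + (cmod (v $ 2))\<^sup>2) = (0::complex)"
    by (simp only: cinner2_2 complex_norm_square[symmetric] of_real_add)
  then have "(cmod (v $ 1))\<^sup>2 + (cmod (v $ 2))\<^sup>2 = 0"
    by (simp only: of_real_eq_0_iff)
  then show "v = 0" by (simp add: vec_eq_iff forall_2 sum_power2_eq_zero_iff)
qed (simp add: cinner2_2)

lemma cinner2_commute: "cinner2 v w = cnj (cinner2 w v)"
  by (simp add: cinner2_2 mult.commute)

lemma subspace_orth_compl: "vec.subspace (orth_compl Y)"
  by (simp add: vec.subspace_def orth_compl_def cinner2_simps) (simp add: cinner2_2)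

lemma orth_compl_disjoint: "v \<in> Y \<Longrightarrow> v \<in> orth_compl Y \<Longrightarrow> v = 0"
  by (auto simp: orth_compl_def cinner2_self_eq_0_iff)

text \<open>The decomposition is taken in the underlying real Euclidean space, whose inner product
  is the real part of \<open>cinner2\<close>. Since \<open>Y\<close> is stable under multiplication
  by \<i>, real orthogonality to both \<open>w\<close> and \<open>\<i> *s w\<close> kills the
  imaginary part as well.\<close>

lemma orth_decomp_exists:
  fixes v :: "complex^2"
  assumes Y: "vec.subspace Y"
  obtains y where "y \<in> Y" "v - y \<in> orth_compl Y"
proof -
  have scale: "r *\<^sub>R w = of_real r *s w" for r :: real and w :: "complex^2"
    by (simp add: vec_eq_iff scaleR_conv_of_real[where 'a=complex])
  have "subspace Y"
    using Y by (auto simp: subspace_def vec.subspace_def scale)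
  then have sp: "span Y = Y" by (simp add: span_eq_iff)
  obtain y z where y: "y \<in> Y" and z: "\<And>w. w \<in> Y \<Longrightarrow> orthogonal z w" and v: "v = y + z"
    using orthogonal_subspace_decomp_exists[of Y v] unfolding sp by blast
  have inner: "z \<bullet> w = Re (cinner2 z w)" for w
    by (simp add: inner_vec_def sum_2 cinner2_2 inner_complex_def)
  have "cinner2 z w = 0" if "w \<in> Y" for w
  proof -
    have "\<i> *s w \<in> Y" using Y that by (simp add: vec.subspace_def)
    then have "Re (cinner2 z (\<i> *s w)) = 0" "Re (cinner2 z w) = 0"
      using z that by (auto simp: orthogonal_def inner)
    then show ?thesis by (simp add: cinner2_simps complex_eq_iff)
  qed
  then have "v - y \<in> orth_compl Y" using v by (simp add: orth_compl_def)
  then show thesis using y that by blast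
qed

text \<open>Uniqueness of the decomposition does all the work: it makes the map to the
  \<open>Y\<close>-component additive and homogeneous, hence a matrix, and it leaves no second
  matrix for the definite description.\<close>

lemma orth_proj_works:
  assumes Y: "vec.subspace Y"
  shows "orth_proj Y *v v \<in> Y" "v - orth_proj Y *v v \<in> orth_compl Y"
proof -
  \<comment> \<open>The difference of two candidates lies both in \<open>Y\<close> and in its
    complement.\<close>
  have uniq: "y = y'" if "y \<in> Y" "v - y \<in> orth_compl Y" "y' \<in> Y" "v - y' \<in> orth_compl Y" for v y y'
  proof -
    have "y - y' \<in> Y" using that Y by (simp add: vec.subspace_diff)
    moreover have "(v - y') - (v - y) \<in> orth_compl Y"
      using that subspace_orth_compl by (blast intro: vec.subspace_diff)
    ultimately show ?thesis using orth_compl_disjoint[of "y - y'"] by simp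
  qed
  have "\<forall>v. \<exists>y. y \<in> Y \<and> v - y \<in> orth_compl Y"
    using orth_decomp_exists[OF Y] by metis
  then obtain p where p: "p v \<in> Y" "v - p v \<in> orth_compl Y" for v
    by metis
  have add: "p (v + w) = p v + p w" for v w
  proof (rule uniq[of _ "v + w"])
    show "v + w - (p v + p w) \<in> orth_compl Y"
      using vec.subspace_add[OF subspace_orth_compl p(2)[of v] p(2)[of w]] by (simp add: algebra_simps)
  qed (use p Y in \<open>auto intro: vec.subspace_add\<close>)
  have scale: "p (a *s v) = a *s p v" for a v
  proof (rule uniq[of _ "a *s v"])
    show "a *s v - a *s p v \<in> orth_compl Y"
      using vec.subspace_scale[OF subspace_orth_compl p(2)[of v], of a]
      by (simp add: vec.scale_right_diff_distrib)
  qed (use p Y in \<open>auto intro: vec.subspace_scale\<close>)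
  have "Vector_Spaces.linear (*s) (*s) p"
    by unfold_locales (simp_all add: add scale)
  from matrix_works[OF this] have Q: "matrix p *v v = p v" for v .
  have "\<forall>v. orth_proj Y *v v \<in> Y \<and> v - orth_proj Y *v v \<in> orth_compl Y"
    unfolding orth_proj_def
  proof (rule theI)
    show "\<forall>v. matrix p *v v \<in> Y \<and> v - matrix p *v v \<in> orth_compl Y"
      by (simp add: Q p)
    fix Q' assume Q': "\<forall>v. Q' *v v \<in> Y \<and> v - Q' *v v \<in> orth_compl Y"
    show "Q' = matrix p"
      unfolding matrix_eq Q using uniq p Q' by blast
  qed
  then show "orth_proj Y *v v \<in> Y" "v - orth_proj Y *v v \<in> orth_compl Y" by auto
qed

lemma orth_proj_eq_0_iff:
  assumes "vec.subspace Y"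
  shows "orth_proj Y *v v = 0 \<longleftrightarrow> v \<in> orth_compl Y"
proof
  assume "v \<in> orth_compl Y"
  then have "v - (v - orth_proj Y *v v) \<in> orth_compl Y"
    using orth_proj_works[OF assms] subspace_orth_compl by (blast intro: vec.subspace_diff)
  then show "orth_proj Y *v v = 0"
    using orth_compl_disjoint[OF orth_proj_works(1)[OF assms]] by simp
qed (use orth_proj_works(2)[OF assms, of v] in simp)

text \<open>For \<open>v\<close> in the double complement, the part of \<open>v\<close> orthogonal
  to \<open>Y\<close> lies in the complement and in the double complement, so it vanishes.\<close>

lemma orth_compl_orth_compl:
  assumes "vec.subspace Y"
  shows "orth_compl (orth_compl Y) = Y"
proof
  show sub: "Y \<subseteq> orth_compl (orth_compl Y)"
    by (auto simp: orth_compl_def) (metis cinner2_commute complex_cnj_zero)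
  show "orth_compl (orth_compl Y) \<subseteq> Y"
  proof
    fix v assume v: "v \<in> orth_compl (orth_compl Y)"
    obtain y where y: "y \<in> Y" "v - y \<in> orth_compl Y" using orth_decomp_exists[OF assms] .
    have "v - y \<in> orth_compl (orth_compl Y)"
      using v y(1) sub subspace_orth_compl by (blast intro: vec.subspace_diff)
    with y show "v \<in> Y" using orth_compl_disjoint[OF y(2)] by simp
  qed
qed

section \<open>Square-integrable functions on the unit interval\<close>

lemma space_I01 [simp]: "space I01 = {0<..<1}"
  by (simp add: space_restrict_space)

lemma ident_measurable_I01 [measurable]: "(\<lambda>x. x) \<in> borel_measurable I01"
  by (rule measurable_restrict_space1) simp

lemma finite_measure_I01: "finite_measure I01"
  by (rule finite_measureI) (simp add: emeasure_restrict_space)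

interpretation I01: finite_measure I01
  by (rule finite_measure_I01)

interpretation I01_pair: pair_sigma_finite I01 I01
  by unfold_locales

lemma measure_I01 [simp]: "measure I01 {0<..<1} = 1"
  by (simp add: measure_restrict_space)

lemma continuous_measurable_I01:
  fixes f :: "real \<Rightarrow> complex"
  assumes "continuous_on {0<..<1} f"
  shows "f \<in> borel_measurable I01"
proof -
  have "f \<in> borel_measurable (restrict_space borel {0<..<1})"
    using assms by (rule borel_measurable_continuous_on_restrict)
  then show ?thesis
    by (simp add: borel_measurable_restrict_space_iff)
qed

lemma L2_measurable: "f \<in> L2 \<Longrightarrow> f \<in> borel_measurable I01"
  and L2_square_integrable: "f \<in> L2 \<Longrightarrow> integrable I01 (\<lambda>x. (cmod (f x))\<^sup>2)"
  by (simp_all add: L2_def)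

lemma L2_dominated:
  assumes f: "f \<in> borel_measurable I01" and g: "integrable I01 g"
    and le: "\<And>x. x \<in> {0<..<1} \<Longrightarrow> (cmod (f x))\<^sup>2 \<le> g x"
  shows "f \<in> L2"
  unfolding L2_def
proof (intro CollectI conjI f, rule Bochner_Integration.integrable_bound[OF g])
  show "(\<lambda>x. (cmod (f x))\<^sup>2) \<in> borel_measurable I01" using f by measurable
  show "AE x in I01. norm ((cmod (f x))\<^sup>2) \<le> norm (g x)"
    using le by (intro AE_I2) force
qed

lemma L2_bounded:
  assumes "f \<in> borel_measurable I01" "\<And>x. x \<in> {0<..<1} \<Longrightarrow> cmod (f x) \<le> B"
  shows "f \<in> L2"
  by (rule L2_dominated[where g = "\<lambda>_. B\<^sup>2"]) (use assms in \<open>auto intro: power_mono\<close>)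

lemma L2_continuous:
  assumes "continuous_on {0..1} f"
  shows "f \<in> L2"
proof -
  have "compact (f ` {0..1})" using assms by (intro compact_continuous_image) auto
  then obtain B where "\<forall>x\<in>{0..1}. cmod (f x) \<le> B"
    by (auto dest!: compact_imp_bounded simp: bounded_iff)
  then show ?thesis
    using assms by (intro L2_bounded[where B = B] continuous_measurable_I01)
      (auto intro: continuous_on_subset)
qed

lemma L2_const: "(\<lambda>_. c) \<in> L2"
  by (rule L2_continuous) simp

lemma L2_scale: "f \<in> L2 \<Longrightarrow> (\<lambda>x. c * f x) \<in> L2"
  by (rule L2_dominated[where g = "\<lambda>x. (cmod c)\<^sup>2 * (cmod (f x))\<^sup>2"])
    (auto simp: L2_def norm_mult power_mult_distrib)

lemma L2_add:
  assumes "f \<in> L2" "g \<in> L2"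
  shows "(\<lambda>x. f x + g x) \<in> L2"
proof (rule L2_dominated)
  show "(\<lambda>x. f x + g x) \<in> borel_measurable I01"
    using assms by (auto simp: L2_def)
  show "integrable I01 (\<lambda>x. 2 * (cmod (f x))\<^sup>2 + 2 * (cmod (g x))\<^sup>2)"
    using assms by (auto simp: L2_def)
  show "(cmod (f x + g x))\<^sup>2 \<le> 2 * (cmod (f x))\<^sup>2 + 2 * (cmod (g x))\<^sup>2" for x
    using power_mono[OF norm_triangle_ineq[of "f x" "g x"], of 2]
      sum_squares_bound[of "cmod (f x)" "cmod (g x)"]
    by (simp add: power2_sum)
qed

lemma L2_diff: "f \<in> L2 \<Longrightarrow> g \<in> L2 \<Longrightarrow> (\<lambda>x. f x - g x) \<in> L2"
  using L2_add[of f "\<lambda>x. (- 1) * g x"] L2_scale[of g "- 1"] by simp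

lemma L2_cnj: "f \<in> L2 \<Longrightarrow> (\<lambda>x. cnj (f x)) \<in> L2"
  using borel_measurable_continuous_on[OF continuous_on_cnj[OF continuous_on_id], of f I01]
  by (auto simp: L2_def)

lemma L2_mult_integrable:
  assumes "f \<in> L2" "g \<in> L2"
  shows "integrable I01 (\<lambda>x. f x * g x)"
proof (rule Bochner_Integration.integrable_bound)
  show "integrable I01 (\<lambda>x. (cmod (f x))\<^sup>2 + (cmod (g x))\<^sup>2)"
    using assms by (auto simp: L2_def)
  show "(\<lambda>x. f x * g x) \<in> borel_measurable I01"
    using assms by (auto simp: L2_def)
  have "cmod (f x) * cmod (g x) \<le> (cmod (f x))\<^sup>2 + (cmod (g x))\<^sup>2" for x
    using sum_squares_bound[of "cmod (f x)" "cmod (g x)"]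
      zero_le_power2[of "cmod (f x)"] zero_le_power2[of "cmod (g x)"]
      mult_nonneg_nonneg[OF norm_ge_zero[of "f x"] norm_ge_zero[of "g x"]]
    by linarith
  then show "AE x in I01. norm (f x * g x) \<le> norm ((cmod (f x))\<^sup>2 + (cmod (g x))\<^sup>2)"
    by (auto simp: norm_mult)
qed

lemma L2_integrable: "f \<in> L2 \<Longrightarrow> integrable I01 f"
  using L2_mult_integrable[OF _ L2_const[of 1]] by simp

text \<open>Cauchy-Schwarz: integrate the inequality between \<open>2 * a * b\<close> and the sum of
  squares, with \<open>a\<close>, \<open>b\<close> the moduli of \<open>f\<close>, \<open>g\<close>
  scaled by free weights \<open>s\<close> and \<open>t\<close>, then choose the weights.\<close>

lemma L2_norm_mult_le:
  assumes "f \<in> L2" "g \<in> L2"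
  shows "cmod (LINT x|I01. f x * g x)
    \<le> sqrt (LINT x|I01. (cmod (f x))\<^sup>2) * sqrt (LINT x|I01. (cmod (g x))\<^sup>2)"
proof -
  define A where "A = (LINT x|I01. (cmod (f x))\<^sup>2)"
  define B where "B = (LINT x|I01. (cmod (g x))\<^sup>2)"
  define I where "I = (LINT x|I01. cmod (f x) * cmod (g x))"
  have [simp]: "A \<ge> 0" "B \<ge> 0" "I \<ge> 0" by (simp_all add: A_def B_def I_def)
  have int: "integrable I01 (\<lambda>x. cmod (f x) * cmod (g x))"
    using integrable_norm[OF L2_mult_integrable[OF assms]] by (simp add: norm_mult)
  have quad: "2 * s * t * I \<le> s\<^sup>2 * A + t\<^sup>2 * B" for s t :: real
  proof -
    have "(LINT x|I01. 2 * s * t * (cmod (f x) * cmod (g x)))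
        \<le> (LINT x|I01. s\<^sup>2 * (cmod (f x))\<^sup>2 + t\<^sup>2 * (cmod (g x))\<^sup>2)"
    proof (rule integral_mono)
      show "2 * s * t * (cmod (f x) * cmod (g x)) \<le> s\<^sup>2 * (cmod (f x))\<^sup>2 + t\<^sup>2 * (cmod (g x))\<^sup>2" for x
        using sum_squares_bound[of "s * cmod (f x)" "t * cmod (g x)"]
        by (simp add: power_mult_distrib algebra_simps)
    qed (use assms int in \<open>auto simp: L2_def\<close>)
    then show ?thesis using assms by (simp add: L2_def A_def B_def I_def)
  qed
  have "I \<le> sqrt A * sqrt B"
  proof (cases "A = 0 \<or> B = 0")
    case True
    have "I = 0"
    proof (rule ccontr)
      assume "I \<noteq> 0"
      then have "I > 0" by (simp add: less_le)
      show False
      proof (cases "A = 0")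
        case True
        \<comment> \<open>With \<open>A = 0\<close> this weight turns \<open>quad\<close> into
          \<open>2 * (B + 1) \<le> B\<close>, which is absurd for nonnegative \<open>B\<close>. The
          other case is symmetric.\<close>
        with quad[of "(B + 1) / I" 1] \<open>I > 0\<close> show False by simp (use \<open>B \<ge> 0\<close> in linarith)
      next
        case False
        then have "B = 0" using \<open>A = 0 \<or> B = 0\<close> by simp
        with quad[of 1 "(A + 1) / I"] \<open>I > 0\<close> show False by simp (use \<open>A \<ge> 0\<close> in linarith)
      qed
    qed
    then show ?thesis by simp
  next
    case False
    then have pos: "sqrt A > 0" "sqrt B > 0" by (simp_all add: less_le)
    \<comment> \<open>These weights make both terms on the right equal to \<open>A * B\<close>;
      cancelling the positive factor leaves the claim.\<close>
    have "2 * (sqrt A * sqrt B) * I \<le> (sqrt B)\<^sup>2 * A + (sqrt A)\<^sup>2 * B"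
      using quad[of "sqrt B" "sqrt A"] by (simp add: mult.commute)
    also have "\<dots> = 2 * (sqrt A * sqrt B) * (sqrt A * sqrt B)"
      by (simp add: algebra_simps)
    finally show ?thesis using pos by (simp add: mult_le_cancel_left_pos)
  qed
  moreover have "cmod (LINT x|I01. f x * g x) \<le> I"
    unfolding I_def using integral_norm_bound[of I01 "\<lambda>x. f x * g x"] by (simp add: norm_mult)
  ultimately show ?thesis by (simp add: A_def B_def)
qed

lemma L2_self_orthogonal:
  assumes f: "f \<in> L2" and 0: "L2_inner f f = 0"
  shows "AE x in I01. f x = 0"
proof -
  have "of_real (LINT x|I01. (cmod (f x))\<^sup>2) = L2_inner f f"
    unfolding L2_inner_def complex_norm_square[symmetric]
    by (rule integral_of_real[symmetric]) (use f in \<open>simp add: L2_def\<close>)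
  then have "(LINT x|I01. (cmod (f x))\<^sup>2) = 0" using 0 by simp
  then show ?thesis
    using f by (subst (asm) integral_nonneg_eq_0_iff_AE) (auto simp: L2_def)
qed

section \<open>Integration from the left and up to the right endpoint, and the duality of the
  two\<close>

definition head_integral :: "(real \<Rightarrow> complex) \<Rightarrow> real \<Rightarrow> complex" where
  "head_integral f x = (LINT t:{0..x}|I01. f t)"

definition tail_integral :: "(real \<Rightarrow> complex) \<Rightarrow> real \<Rightarrow> complex" where
  "tail_integral f x = (LINT t:{x..1}|I01. f t)"

text \<open>Bridge from the Lebesgue integral over the open interval to the gauge integral over
  closed ones, where the fundamental theorem of calculus is available. The domains differ at most in
  the points 0 and 1.\<close>

lemma set_integral_I01:
  fixes f :: "real \<Rightarrow> complex"
  assumes f: "integrable I01 f" and "0 \<le> a" "b \<le> 1"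
  shows "f integrable_on {a..b}" "(LINT t:{a..b}|I01. f t) = integral {a..b} f"
proof -
  let ?S = "{a..b} \<inter> {0<..<1}"
  have "set_integrable lborel {0<..<1} f"
    using f by (simp add: set_integrable_def integrable_restrict_space)
  then have S: "set_integrable lborel ?S f"
    by (rule set_integrable_subset) auto
  have sub: "?S - {a..b} \<union> ({a..b} - ?S) \<subseteq> {0,1}"
    using assms by auto
  have neg: "negligible (?S - {a..b})" "negligible ({a..b} - ?S)"
    by (rule negligible_subset[of "{0,1}"]; use sub in auto)+
  have "(LINT t:{a..b}|I01. f t) = (LINT t:?S|lborel. f t)"
    unfolding set_lebesgue_integral_def
    by (simp add: integral_restrict_space indicator_inter_arith mult.commute)
  also have "\<dots> = integral ?S f"
    by (rule set_borel_integral_eq_integral(2)[OF S])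
  also have "\<dots> = integral {a..b} f"
    by (rule integral_subset_negligible; use neg in auto)
  finally show "(LINT t:{a..b}|I01. f t) = integral {a..b} f" .
  show "f integrable_on {a..b}"
    using set_borel_integral_eq_integral(1)[OF S]
    by (rule integrable_spike_set; intro negligible_subset[OF neg(1)] negligible_subset[OF neg(2)]) auto
qed

lemma integral_I01_conv:
  fixes f :: "real \<Rightarrow> complex"
  assumes "integrable I01 f"
  shows "(LINT t|I01. f t) = integral {0..1} f"
proof -
  have "(LINT t|I01. f t) = (LINT t:{0..1}|I01. f t)"
    unfolding set_lebesgue_integral_def by (rule Bochner_Integration.integral_cong) auto
  then show ?thesis using set_integral_I01[OF assms, of 0 1] by simp
qed

lemma set_integral_I01_FTC:
  fixes f F :: "real \<Rightarrow> complex"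
  assumes f: "integrable I01 f" and "0 \<le> a" "a \<le> b" "b \<le> 1"
    and "\<And>x. (F has_vector_derivative f x) (at x)"
  shows "(LINT t:{a..b}|I01. f t) = F b - F a"
proof -
  have "(f has_integral (F b - F a)) {a..b}"
    using assms by (intro fundamental_theorem_of_calculus) (auto intro: has_vector_derivative_at_within)
  then show ?thesis using set_integral_I01[OF f, of a b] assms by (simp add: integral_unique)
qed

text \<open>With the constraint on \<open>t\<close> moved into the integrand, each function is a
  parameter integral of a jointly measurable function.\<close>

lemma
  fixes f :: "real \<Rightarrow> complex"
  assumes f [measurable]: "f \<in> borel_measurable I01"
  shows head_integral_measurable [measurable]: "head_integral f \<in> borel_measurable I01"
    and tail_integral_measurable [measurable]: "tail_integral f \<in> borel_measurable I01"
proof -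
  have "(\<lambda>x. LINT t|I01. (if 0 \<le> t \<and> t \<le> x then f t else 0)) \<in> borel_measurable I01"
    by measurable
  then show "head_integral f \<in> borel_measurable I01"
    unfolding head_integral_def[abs_def] set_lebesgue_integral_def
    by (rule measurable_cong[THEN iffD1, rotated])
      (auto intro!: Bochner_Integration.integral_cong simp: indicator_def)
  have "(\<lambda>x. LINT t|I01. (if x \<le> t \<and> t \<le> 1 then f t else 0)) \<in> borel_measurable I01"
    by measurable
  then show "tail_integral f \<in> borel_measurable I01"
    unfolding tail_integral_def[abs_def] set_lebesgue_integral_def
    by (rule measurable_cong[THEN iffD1, rotated])
      (auto intro!: Bochner_Integration.integral_cong simp: indicator_def)
qed

lemma set_integral_I01_bound:
  fixes f :: "real \<Rightarrow> complex"
  assumes "integrable I01 f" "A \<in> sets borel"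
  shows "cmod (LINT t:A|I01. f t) \<le> (LINT t|I01. cmod (f t))"
proof -
  have "cmod (LINT t:A|I01. f t) \<le> (LINT t|I01. cmod (indicator A t *\<^sub>R f t))"
    unfolding set_lebesgue_integral_def by (rule integral_norm_bound)
  also have "\<dots> \<le> (LINT t|I01. cmod (f t))"
  proof (rule integral_mono_AE)
    have "(\<lambda>t. indicator A t :: real) \<in> borel_measurable I01"
      using assms by (intro measurable_restrict_space1) simp
    then show "integrable I01 (\<lambda>t. cmod (indicator A t *\<^sub>R f t))"
      using assms(1) by (intro integrable_norm Bochner_Integration.integrable_bound[OF assms(1)])
        (auto simp: indicator_def)
  qed (use assms in \<open>auto simp: indicator_def\<close>)
  finally show ?thesis .
qed

lemma head_integral_L2: "f \<in> L2 \<Longrightarrow> head_integral f \<in> L2"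
  by (rule L2_bounded[OF head_integral_measurable[OF L2_measurable]])
    (auto simp: head_integral_def intro!: set_integral_I01_bound L2_integrable)

lemma tail_integral_L2: "f \<in> L2 \<Longrightarrow> tail_integral f \<in> L2"
  by (rule L2_bounded[OF tail_integral_measurable[OF L2_measurable]])
    (auto simp: tail_integral_def intro!: set_integral_I01_bound L2_integrable)

text \<open>Both sides integrate \<open>f x * g y\<close> over the triangle
  \<open>x \<le> y\<close>, in the two possible orders. The pairing is bilinear, without
  conjugation, as in the definition of \<open>P\<close>.\<close>

lemma tail_integral_adjoint:
  assumes f: "f \<in> L2" and g: "g \<in> L2"
  shows "(LINT x|I01. f x * tail_integral g x) = (LINT x|I01. head_integral f x * g x)"
proof -
  note [measurable] = L2_measurable[OF f] L2_measurable[OF g]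
  note int = L2_integrable[OF f] L2_integrable[OF g]
  \<comment> \<open>Fubini needs integrability over the triangle; it is inherited from the product
    function on the whole square, which dominates.\<close>
  have "integrable (I01 \<Otimes>\<^sub>M I01) (\<lambda>p. f (fst p) * g (snd p))"
    by (rule I01_pair.Fubini_integrable) (use int in \<open>auto simp: norm_mult\<close>)
  then have "integrable (I01 \<Otimes>\<^sub>M I01) (\<lambda>(x, y). if x \<le> y then f x * g y else 0)"
    by (rule Bochner_Integration.integrable_bound) auto
  from I01_pair.Fubini_integral[OF this]
  have "(LINT y|I01. LINT x|I01. (if x \<le> y then f x * g y else 0)) =
      (LINT x|I01. LINT y|I01. (if x \<le> y then f x * g y else 0))" .
  moreover have "(LINT x|I01. (if x \<le> y then f x * g y else 0)) = head_integral f y * g y" for y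
    unfolding head_integral_def set_lebesgue_integral_def integral_mult_left_zero[symmetric]
    by (rule Bochner_Integration.integral_cong) (auto simp: indicator_def)
  moreover have "(LINT y|I01. (if x \<le> y then f x * g y else 0)) = f x * tail_integral g x" for x
    unfolding tail_integral_def set_lebesgue_integral_def integral_mult_right_zero[symmetric]
    by (rule Bochner_Integration.integral_cong) (auto simp: indicator_def)
  ultimately show ?thesis by simp
qed

section \<open>The inner product of the dual space\<close>

lemma head_integral_add:
  assumes "f \<in> L2" "g \<in> L2"
  shows "head_integral (\<lambda>x. f x + g x) x = head_integral f x + head_integral g x"
proof -
  have "set_integrable I01 {0..x} h" if "h \<in> L2" for h
    unfolding set_integrable_def
  proof (rule Bochner_Integration.integrable_bound[OF L2_integrable[OF that]])
    have "(\<lambda>t. indicator {0..x} t :: real) \<in> borel_measurable I01"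
      by (intro measurable_restrict_space1) simp
    then show "(\<lambda>t. indicator {0..x} t *\<^sub>R h t) \<in> borel_measurable I01"
      using L2_measurable[OF that] by simp
  qed (auto simp: indicator_def)
  then show ?thesis
    using assms unfolding head_integral_def by (intro set_integral_add(2)) auto
qed

lemma head_integral_scale: "head_integral (\<lambda>x. c * f x) x = c * head_integral f x"
  unfolding head_integral_def set_lebesgue_integral_def
  by (simp only: mult_scaleR_right[symmetric] integral_mult_right_zero)

lemma H1_deriv_iff:
  "H1_deriv u v \<longleftrightarrow> v \<in> L2 \<and> (\<forall>x\<in>{0..1}. u x = u 0 + head_integral v x)"
  by (simp add: H1_deriv_def head_integral_def)

lemma H1_deriv_add:
  assumes u: "H1_deriv u v" and u': "H1_deriv u' v'"
  shows "H1_deriv (\<lambda>x. u x + u' x) (\<lambda>x. v x + v' x)"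
proof -
  have L2: "v \<in> L2" "v' \<in> L2" using u u' unfolding H1_deriv_iff by blast+
  have "u x + u' x = u 0 + u' 0 + head_integral (\<lambda>x. v x + v' x) x" if "x \<in> {0..1}" for x
  proof -
    have "u x = u 0 + head_integral v x" "u' x = u' 0 + head_integral v' x"
      using u u' that unfolding H1_deriv_iff by blast+
    then show ?thesis by (simp add: head_integral_add L2)
  qed
  then show ?thesis using L2_add[OF L2] unfolding H1_deriv_iff by blast
qed

lemma H1_deriv_scale:
  assumes u: "H1_deriv u v"
  shows "H1_deriv (\<lambda>x. c * u x) (\<lambda>x. c * v x)"
proof -
  have L2: "v \<in> L2" using u unfolding H1_deriv_iff by blast
  have "c * u x = c * u 0 + head_integral (\<lambda>x. c * v x) x" if "x \<in> {0..1}" for x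
  proof -
    have "u x = u 0 + head_integral v x"
      using u that unfolding H1_deriv_iff by blast
    then show ?thesis by (simp add: head_integral_scale distrib_left)
  qed
  then show ?thesis using L2_scale[OF L2] unfolding H1_deriv_iff by blast
qed

lemma H1T_add: "u \<in> H1T \<Longrightarrow> u' \<in> H1T \<Longrightarrow> (\<lambda>x. u x + u' x) \<in> H1T"
  using H1_deriv_add by (fastforce simp: H1T_def)

lemma H1T_scale: "u \<in> H1T \<Longrightarrow> (\<lambda>x. c * u x) \<in> H1T"
  using H1_deriv_scale by (fastforce simp: H1T_def)

lemma H1T_const: "(\<lambda>_. c) \<in> H1T"
proof -
  have "H1_deriv (\<lambda>_. c) (\<lambda>_. 0)"
    by (simp add: H1_deriv_iff L2_const head_integral_def)
  then show ?thesis by (auto simp: H1T_def)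
qed

text \<open>On the unit interval \<open>u\<close> is a constant plus the integral of its derivative,
  which is square integrable; values elsewhere do not enter.\<close>

lemma H1T_L2:
  assumes "u \<in> H1T"
  shows "u \<in> L2"
proof -
  obtain v c where "v \<in> L2" and u: "\<And>x. x \<in> {0..1} \<Longrightarrow> u x = c + head_integral v x"
    using assms unfolding H1T_def H1_deriv_iff by blast
  then have *: "(\<lambda>x. c + head_integral v x) \<in> L2"
    by (intro L2_add L2_const head_integral_L2)
  have "u \<in> borel_measurable I01"
    by (rule measurable_cong[THEN iffD1, OF _ L2_measurable[OF *]]) (simp add: u)
  moreover have "integrable I01 (\<lambda>x. (cmod (u x))\<^sup>2)"
    by (rule Bochner_Integration.integrable_cong[THEN iffD1, OF refl _ L2_square_integrable[OF *]])
      (simp add: u)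
  ultimately show ?thesis by (simp add: L2_def)
qed

lemma set_integral_I01_split:
  fixes f :: "real \<Rightarrow> complex"
  assumes f: "integrable I01 f" and x: "x \<in> {0..1}"
  shows "head_integral f x + tail_integral f x = (LINT t|I01. f t)"
  using set_integral_I01[OF f, of 0 x] set_integral_I01[OF f, of x 1] set_integral_I01[OF f, of 0 1]
    Henstock_Kurzweil_Integration.integral_combine[of 0 x 1 f] x
  by (simp add: head_integral_def tail_integral_def integral_I01_conv[OF f])

lemma mean_zero_L2: "f \<in> L2 \<Longrightarrow> (\<lambda>y. f y - (LINT z|I01. f z)) \<in> L2"
  by (intro L2_diff L2_const)

lemma mean_zero_integral: "f \<in> L2 \<Longrightarrow> (LINT y|I01. f y - (LINT z|I01. f z)) = 0"
  by (simp add: L2_integrable)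

lemma J_eq_tail_integral: "J \<phi> = tail_integral (\<lambda>y. \<phi> y - (LINT z|I01. \<phi> z))"
  by (simp add: fun_eq_iff J_def tail_integral_def)

text \<open>Subtracting the mean makes the total integral of \<open>g\<close> vanish. Hence
  \<open>J \<phi>\<close> is minus the integral of \<open>g\<close> from 0, so its derivative is
  \<open>- g\<close>, and it is 0 at both endpoints, which gives periodicity.\<close>

lemma J_H1T:
  assumes "\<phi> \<in> L2"
  shows "J \<phi> \<in> H1T"
proof -
  define g where "g = (\<lambda>y. \<phi> y - (LINT z|I01. \<phi> z))"
  have g: "g \<in> L2" "(LINT y|I01. g y) = 0"
    using assms unfolding g_def by (rule mean_zero_L2, rule mean_zero_integral)
  have J: "J \<phi> x = - head_integral g x" if "x \<in> {0..1}" for x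
    using set_integral_I01_split[OF L2_integrable[OF g(1)] that] g(2)
    by (simp add: J_eq_tail_integral g_def[symmetric] eq_neg_iff_add_eq_0 add.commute)
  have "head_integral g 0 = 0"
    using set_integral_I01(2)[OF L2_integrable[OF g(1)], of 0 0] by (simp add: head_integral_def)
  moreover have "head_integral g 1 = 0"
    using set_integral_I01(2)[OF L2_integrable[OF g(1)], of 0 1] g(2)
      integral_I01_conv[OF L2_integrable[OF g(1)]] by (simp add: head_integral_def)
  moreover have "H1_deriv (J \<phi>) (\<lambda>x. (- 1) * g x)"
    unfolding H1_deriv_iff head_integral_scale
    using J \<open>head_integral g 0 = 0\<close> L2_scale[OF g(1), of "- 1"] by simp
  ultimately show ?thesis
    using J by (auto simp: H1T_def)
qed

text \<open>The L2 norm of \<open>f\<close> serves as the bound, by Cauchy-Schwarz; the derivative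
  term only enlarges the right-hand side.\<close>

lemma Hm1_of_Hm1T:
  assumes f: "f \<in> L2"
  shows "Hm1_of f \<in> Hm1T"
proof -
  have bound: "cmod (Hm1_of f u) \<le> sqrt (LINT x|I01. (cmod (f x))\<^sup>2) *
      sqrt ((LINT x|I01. (cmod (u x))\<^sup>2) + (LINT x|I01. (cmod (v x))\<^sup>2))"
    if "u \<in> H1T" for u v
  proof -
    have "cmod (Hm1_of f u) \<le> sqrt (LINT x|I01. (cmod (f x))\<^sup>2) * sqrt (LINT x|I01. (cmod (u x))\<^sup>2)"
      using L2_norm_mult_le[OF f H1T_L2[OF that]] that by (simp add: Hm1_of_def)
    also have "\<dots> \<le> sqrt (LINT x|I01. (cmod (f x))\<^sup>2) *
      sqrt ((LINT x|I01. (cmod (u x))\<^sup>2) + (LINT x|I01. (cmod (v x))\<^sup>2))"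
      by (intro mult_left_mono real_sqrt_le_mono) auto
    finally show ?thesis .
  qed
  show ?thesis
    unfolding Hm1T_def
  proof (intro CollectI conjI ballI allI)
    show "Hm1_of f \<in> extensional H1T" by (simp add: Hm1_of_def)
  next
    fix u v assume "u \<in> H1T" "v \<in> H1T"
    then show "Hm1_of f (\<lambda>x. u x + v x) = Hm1_of f u + Hm1_of f v"
      by (simp add: Hm1_of_def H1T_add distrib_left L2_mult_integrable f H1T_L2)
  next
    fix c u assume "u \<in> H1T"
    then show "Hm1_of f (\<lambda>x. c * u x) = c * Hm1_of f u"
      by (simp add: Hm1_of_def H1T_scale mult.left_commute[of _ c])
  next
    show "\<exists>C. \<forall>u v. u \<in> H1T \<longrightarrow> H1_deriv u v \<longrightarrow> cmod (Hm1_of f u)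
        \<le> C * sqrt ((LINT x|I01. (cmod (u x))\<^sup>2) + (LINT x|I01. (cmod (v x))\<^sup>2))"
      using bound by blast
  qed
qed

section \<open>Explicit form of \<open>P\<close> and of the dual inner product on L2\<close>

lemma mu0_Hm1_of: "mu0 (Hm1_of f) = (LINT x|I01. f x)"
  by (simp add: mu0_def Hm1_of_def H1T_const)

lemma Gamma1_nth [simp]: "Gamma1 f $ 1 = (LINT x|I01. f x)" "Gamma1 f $ 2 = mu1 f"
  by (simp_all add: Gamma1_def mu0_Hm1_of)

lemma Hm1_scale_Hm1_of: "Hm1_scale c (Hm1_of f) = Hm1_of (\<lambda>x. c * f x)"
  by (auto simp: Hm1_scale_def Hm1_of_def mult.assoc restrict_def)

lemma tail_integral_one: "x \<in> {0..1} \<Longrightarrow> tail_integral (\<lambda>_. 1) x = of_real (1 - x)"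
  unfolding tail_integral_def
  by (subst set_integral_I01(2)) (auto simp: of_real_def)

text \<open>The weight \<open>1 - x\<close> in \<open>mu1\<close> is the tail integral of the
  constant 1, so transposition identifies \<open>mu1 f\<close> as the mean of the primitive of
  \<open>f\<close>.\<close>

lemma integral_head_integral:
  assumes "f \<in> L2"
  shows "(LINT x|I01. head_integral f x) = mu1 f"
proof -
  have "(LINT x|I01. head_integral f x) = (LINT x|I01. f x * tail_integral (\<lambda>_. 1) x)"
    using tail_integral_adjoint[OF assms L2_const[of 1]] by simp
  also have "\<dots> = mu1 f"
    unfolding mu1_def by (rule Bochner_Integration.integral_cong) (auto simp: tail_integral_one)
  finally show ?thesis .
qed

text \<open>The primitive of \<open>f\<close> normalised to mean zero: this is \<open>P\<close> on
  L2 functions.\<close>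

definition mean_zero_head :: "(real \<Rightarrow> complex) \<Rightarrow> real \<Rightarrow> complex" where
  "mean_zero_head f x = head_integral f x - mu1 f"

lemma mean_zero_head_L2: "f \<in> L2 \<Longrightarrow> mean_zero_head f \<in> L2"
  unfolding mean_zero_head_def[abs_def] by (intro L2_diff L2_const head_integral_L2)

lemma integral_mean_zero_head: "f \<in> L2 \<Longrightarrow> (LINT x|I01. mean_zero_head f x) = 0"
  by (simp add: mean_zero_head_def L2_integrable head_integral_L2 integral_head_integral)

text \<open>Transposing the tail integral inside \<open>J\<close> pairs the primitive of
  \<open>f\<close> with the centred test function. Moving the centring from the test function to the
  primitive subtracts its mean \<open>mu1 f\<close>.\<close>

lemma mean_zero_head_works:
  assumes f: "f \<in> L2" and \<phi>: "\<phi> \<in> L2"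
  shows "(LINT x|I01. mean_zero_head f x * \<phi> x) = Hm1_of f (J \<phi>)"
proof -
  let ?m = "LINT z|I01. \<phi> z"
  note int = L2_mult_integrable[OF head_integral_L2[OF f] \<phi>] L2_integrable[OF head_integral_L2[OF f]]
    L2_integrable[OF \<phi>]
  have "Hm1_of f (J \<phi>) = (LINT x|I01. f x * tail_integral (\<lambda>y. \<phi> y - ?m) x)"
    using J_H1T[OF \<phi>] by (simp add: Hm1_of_def J_eq_tail_integral)
  also have "\<dots> = (LINT x|I01. head_integral f x * (\<phi> x - ?m))"
    by (rule tail_integral_adjoint[OF f mean_zero_L2[OF \<phi>]])
  also have "\<dots> = (LINT x|I01. head_integral f x * \<phi> x) - mu1 f * ?m"
    using int by (simp add: right_diff_distrib integral_head_integral[OF f])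
  also have "\<dots> = (LINT x|I01. mean_zero_head f x * \<phi> x)"
    using int by (simp add: mean_zero_head_def left_diff_distrib)
  finally show ?thesis by simp
qed

text \<open>\<open>P\<close> is a chosen representer, known only through its pairings.
  \<open>mean_zero_head f\<close> shows that one exists, and any two differ by a function orthogonal
  to itself.\<close>

lemma P_Hm1_of:
  assumes f: "f \<in> L2"
  shows "P (Hm1_of f) \<in> L2" "AE x in I01. P (Hm1_of f) x = mean_zero_head f x"
proof -
  define p where "p = P (Hm1_of f)"
  have "p \<in> L2 \<and> (\<forall>\<phi>\<in>L2. (LINT x|I01. p x * \<phi> x) = Hm1_of f (J \<phi>))"
    unfolding p_def P_def
    by (rule someI[where x = "mean_zero_head f"])
      (use f mean_zero_head_L2 mean_zero_head_works in auto)
  then have p: "p \<in> L2" and *: "(LINT x|I01. p x * \<phi> x) = (LINT x|I01. mean_zero_head f x * \<phi> x)"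
    if "\<phi> \<in> L2" for \<phi>
    using mean_zero_head_works[OF f] that by auto
  have p: "p \<in> L2" using p L2_const by blast
  show "P (Hm1_of f) \<in> L2" using p by (simp add: p_def)
  define d where "d = (\<lambda>x. p x - mean_zero_head f x)"
  have d: "d \<in> L2" unfolding d_def using p mean_zero_head_L2[OF f] by (rule L2_diff)
  \<comment> \<open>The representing identity is bilinear and \<open>L2_inner\<close> is
    sesquilinear, so the test function is the conjugate of \<open>d\<close>.\<close>
  have "L2_inner d d = (LINT x|I01. p x * cnj (d x) - mean_zero_head f x * cnj (d x))"
    by (simp add: L2_inner_def d_def left_diff_distrib)
  also have "\<dots> = 0"
    using *[OF L2_cnj[OF d]] p mean_zero_head_L2[OF f] L2_cnj[OF d]
    by (simp add: L2_mult_integrable)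
  finally have "AE x in I01. d x = 0" using d by (intro L2_self_orthogonal)
  then show "AE x in I01. P (Hm1_of f) x = mean_zero_head f x"
    by eventually_elim (simp add: d_def p_def)
qed

lemma head_integral_cnj: "head_integral (\<lambda>x. cnj (f x)) x = cnj (head_integral f x)"
  unfolding head_integral_def set_lebesgue_integral_def
  by (simp flip: complex_cnj_scaleR)

text \<open>Two integrations are moved off \<open>h\<close>, so that the dual inner product becomes
  an ordinary L2 pairing with \<open>h\<close> plus a term in \<open>Gamma1\<close>. This makes the
  form equation testable against arbitrary \<open>h\<close>.\<close>

lemma Hm1_inner_Hm1_of:
  assumes f: "f \<in> L2" and h: "h \<in> L2"
  shows "Hm1_inner (Hm1_of f) (Hm1_of h) =
    L2_inner (tail_integral (mean_zero_head f)) h + Gamma1 f $ 1 * cnj (Gamma1 h $ 1)"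
proof -
  let ?p = "mean_zero_head f"
  note p = mean_zero_head_L2[OF f]
  have "L2_inner (P (Hm1_of f)) (P (Hm1_of h)) = (LINT x|I01. ?p x * cnj (mean_zero_head h x))"
    unfolding L2_inner_def
  proof (rule integral_cong_AE)
    show "AE x in I01. P (Hm1_of f) x * cnj (P (Hm1_of h) x) = ?p x * cnj (mean_zero_head h x)"
      using P_Hm1_of(2)[OF f] P_Hm1_of(2)[OF h] by eventually_elim simp
  qed (intro borel_measurable_times L2_measurable L2_cnj P_Hm1_of f h mean_zero_head_L2)+
  also have "\<dots> = (LINT x|I01. ?p x * cnj (head_integral h x) - ?p x * cnj (mu1 h))"
    by (simp add: mean_zero_head_def[of h] right_diff_distrib)
  \<comment> \<open>The constant \<open>mu1 h\<close> drops out because \<open>?p\<close> has mean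
    zero.\<close>
  also have "\<dots> = (LINT x|I01. ?p x * cnj (head_integral h x))"
    using p h integral_mean_zero_head[OF f]
    by (simp add: L2_mult_integrable L2_cnj head_integral_L2 L2_integrable)
  also have "\<dots> = (LINT x|I01. head_integral (\<lambda>x. cnj (h x)) x * ?p x)"
    by (simp add: head_integral_cnj mult.commute)
  also have "\<dots> = (LINT x|I01. cnj (h x) * tail_integral ?p x)"
    using tail_integral_adjoint[OF L2_cnj[OF h] p] by simp
  also have "\<dots> = L2_inner (tail_integral ?p) h"
    by (simp add: L2_inner_def mult.commute)
  finally show ?thesis by (simp add: Hm1_inner_def mu0_Hm1_of)
qed

section \<open>The characteristic equation\<close>

lemma set_integral_I01_cong_AE:
  assumes "f \<in> L2" "g \<in> L2" "AE x in I01. f x = g x" "A \<in> sets borel"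
  shows "(LINT x:A|I01. f x) = (LINT x:A|I01. g x)"
  unfolding set_lebesgue_integral_def
proof (rule integral_cong_AE)
  have *: "(\<lambda>t. indicator A t :: real) \<in> borel_measurable I01"
    using assms by (intro measurable_restrict_space1) simp
  show "(\<lambda>x. indicator A x *\<^sub>R f x) \<in> borel_measurable I01"
    "(\<lambda>x. indicator A x *\<^sub>R g x) \<in> borel_measurable I01"
    using * assms by (auto intro: borel_measurable_scaleR L2_measurable)
  show "AE x in I01. indicator A x *\<^sub>R f x = indicator A x *\<^sub>R g x"
    using assms(3) by eventually_elim simp
qed

lemma L2_inner_cong_AE:
  assumes "f \<in> L2" "g \<in> L2" "h \<in> L2" "AE x in I01. f x = g x"
  shows "L2_inner f h = L2_inner g h"
  unfolding L2_inner_def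
proof (rule integral_cong_AE)
  show "AE x in I01. f x * cnj (h x) = g x * cnj (h x)"
    using assms(4) by eventually_elim simp
qed (intro borel_measurable_times L2_measurable L2_cnj assms)+

lemma integral_I01_eq_head_integral: "(LINT x|I01. f x) = head_integral f 1"
  unfolding head_integral_def set_lebesgue_integral_def
  by (rule Bochner_Integration.integral_cong) auto

text \<open>Integration turns almost everywhere equality into equality at every point.\<close>

lemma AE_cong_L2:
  assumes f: "f \<in> L2" and g: "g \<in> L2" and eq: "AE x in I01. f x = g x"
  shows head_integral_cong_AE: "head_integral f = head_integral g"
    and mu1_cong_AE: "mu1 f = mu1 g"
    and Gamma1_cong_AE: "Gamma1 f = Gamma1 g"
    and mean_zero_head_cong_AE: "mean_zero_head f = mean_zero_head g"
proof -
  show *: "head_integral f = head_integral g"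
    unfolding head_integral_def fun_eq_iff
    by (intro allI set_integral_I01_cong_AE f g eq) simp
  then show **: "mu1 f = mu1 g"
    using integral_head_integral[OF f] integral_head_integral[OF g] by simp
  show "Gamma1 f = Gamma1 g"
    using * ** by (simp add: vec_eq_iff forall_2 integral_I01_eq_head_integral)
  show "mean_zero_head f = mean_zero_head g"
    using * ** by (simp add: mean_zero_head_def fun_eq_iff)
qed

lemma mu1_scale: "mu1 (\<lambda>x. c * f x) = c * mu1 f"
  by (simp add: mu1_def mult.left_commute[of _ c])

lemma tail_integral_scale: "tail_integral (\<lambda>x. c * f x) = (\<lambda>x. c * tail_integral f x)"
  unfolding tail_integral_def set_lebesgue_integral_def
  by (simp only: mult_scaleR_right[symmetric] integral_mult_right_zero)

lemma mean_zero_head_scale: "mean_zero_head (\<lambda>x. c * f x) = (\<lambda>x. c * mean_zero_head f x)"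
  by (simp add: mean_zero_head_def fun_eq_iff head_integral_scale mu1_scale right_diff_distrib)

lemma L2_inner_diff:
  assumes "f \<in> L2" "g \<in> L2" "h \<in> L2"
  shows "L2_inner (\<lambda>x. f x - g x) h = L2_inner f h - L2_inner g h"
  using assms by (simp add: L2_inner_def left_diff_distrib L2_mult_integrable L2_cnj)

lemma L2_inner_scale: "L2_inner (\<lambda>x. c * f x) h = c * L2_inner f h"
  by (simp add: L2_inner_def mult.assoc)

section \<open>Affine functions and the kernel of \<open>Gamma1\<close>\<close>

definition affine_fun :: "complex \<Rightarrow> complex \<Rightarrow> real \<Rightarrow> complex" where
  "affine_fun a b x = a + b * of_real (1 - x)"

lemma affine_L2: "affine_fun a b \<in> L2"
  by (rule L2_continuous) (auto simp: affine_fun_def[abs_def] intro!: continuous_intros)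

text \<open>The basis 1 and \<open>1 - x\<close> consists of the two weights defining
  \<open>Gamma1\<close>, so pairing with an affine function sees \<open>h\<close> only through
  \<open>Gamma1 h\<close>.\<close>

lemma L2_inner_affine:
  assumes h: "h \<in> L2"
  shows "L2_inner (affine_fun a b) h = a * cnj (Gamma1 h $ 1) + b * cnj (Gamma1 h $ 2)"
proof -
  have x: "(\<lambda>x. of_real (1 - x)) \<in> L2"
    by (rule L2_continuous) (auto intro!: continuous_intros)
  have "L2_inner (affine_fun a b) h =
      (LINT x|I01. a * cnj (h x) + b * (of_real (1 - x) * cnj (h x)))"
    by (simp add: L2_inner_def affine_fun_def algebra_simps)
  also have "\<dots> = a * (LINT x|I01. cnj (h x)) + b * (LINT x|I01. of_real (1 - x) * cnj (h x))"
    using L2_mult_integrable[OF x L2_cnj[OF h]] L2_integrable[OF L2_cnj[OF h]] by simp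
  also have "\<dots> = a * cnj (Gamma1 h $ 1) + b * cnj (Gamma1 h $ 2)"
  proof -
    have "cnj (mu1 h) = (LINT x|I01. cnj (of_real (1 - x) * h x))"
      unfolding mu1_def by (rule Bochner_Integration.integral_cnj[symmetric])
    then show ?thesis by simp
  qed
  finally show ?thesis .
qed

lemma
  shows integral_affine: "(LINT x|I01. affine_fun a b x) = a + b / 2"
    and mu1_affine: "mu1 (affine_fun a b) = a / 2 + b / 3"
proof -
  note L2 = affine_L2
  have "head_integral (affine_fun a b) 1 = a + b / 2"
  proof -
    define F where "F = (\<lambda>x::real. a * of_real x - b * (1 - of_real x)\<^sup>2 / 2)"
    have "(F has_vector_derivative affine_fun a b x) (at x)" for x
      unfolding F_def affine_fun_def
      by (rule has_vector_derivative_real_field)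
        (auto intro!: derivative_eq_intros simp: field_simps)
    from set_integral_I01_FTC[OF L2_integrable[OF L2], of 0 1 F a b, OF _ _ _ this]
    show ?thesis by (simp add: head_integral_def F_def)
  qed
  then show "(LINT x|I01. affine_fun a b x) = a + b / 2"
    by (simp add: integral_I01_eq_head_integral)
  show "mu1 (affine_fun a b) = a / 2 + b / 3"
  proof -
    define g where "g = (\<lambda>x::real. of_real (1 - x) * affine_fun a b x)"
    define F where "F = (\<lambda>x::real. - a * (1 - of_real x)^2 / 2 - b * (1 - of_real x)^3 / 3)"
    have "(F has_vector_derivative g x) (at x)" for x
      unfolding F_def g_def affine_fun_def
      by (rule has_vector_derivative_real_field)
        (auto intro!: derivative_eq_intros simp: field_simps power2_eq_square)
    moreover have "g \<in> L2"
      by (rule L2_continuous) (auto simp: g_def affine_fun_def intro!: continuous_intros)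
    ultimately have "(LINT x:{0..1}|I01. g x) = F 1 - F 0"
      by (intro set_integral_I01_FTC L2_integrable) auto
    then show ?thesis
      by (simp add: mu1_def integral_I01_eq_head_integral head_integral_def g_def F_def)
  qed
qed

lemma Gamma1_surj:
  obtains h where "h \<in> L2" "Gamma1 h = y"
proof
  \<comment> \<open>Solution of the Gram system \<open>a + b / 2 = y $ 1\<close>,
    \<open>a / 2 + b / 3 = y $ 2\<close>.\<close>
  define b where "b = 12 * y $ 2 - 6 * y $ 1"
  show "Gamma1 (affine_fun (y $ 1 - b / 2) b) = y"
    by (simp add: vec_eq_iff forall_2 integral_affine mu1_affine b_def field_simps)
qed (rule affine_L2)

lemma mu1_diff:
  assumes "f \<in> L2" "g \<in> L2"
  shows "mu1 (\<lambda>x. f x - g x) = mu1 f - mu1 g"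
proof -
  have x: "(\<lambda>x. of_real (1 - x)) \<in> L2"
    by (rule L2_continuous) (auto intro!: continuous_intros)
  show ?thesis
    unfolding mu1_def right_diff_distrib
    by (intro Bochner_Integration.integral_diff L2_mult_integrable x assms)
qed

lemma Gamma1_diff: "f \<in> L2 \<Longrightarrow> g \<in> L2 \<Longrightarrow> Gamma1 (\<lambda>x. f x - g x) = Gamma1 f - Gamma1 g"
  by (simp add: vec_eq_iff forall_2 mu1_diff L2_integrable)

text \<open>Subtract from \<open>r\<close> the affine function with the same \<open>Gamma1\<close>.
  The remainder \<open>s\<close> lies in the kernel, hence is orthogonal to \<open>r\<close> by
  assumption and to affine functions by \<open>L2_inner_affine\<close>, so to itself.\<close>

lemma orthogonal_to_Gamma1_kernel:
  assumes r: "r \<in> L2" and orth: "\<And>h. h \<in> L2 \<Longrightarrow> Gamma1 h = 0 \<Longrightarrow> L2_inner r h = 0"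
  obtains a b where "AE x in I01. r x = affine_fun a b x"
proof -
  define b where "b = 12 * Gamma1 r $ 2 - 6 * Gamma1 r $ 1"
  define a where "a = Gamma1 r $ 1 - b / 2"
  define s where "s = (\<lambda>x. r x - affine_fun a b x)"
  have s: "s \<in> L2" unfolding s_def using r affine_L2 by (rule L2_diff)
  have "Gamma1 (affine_fun a b) = Gamma1 r"
    by (simp add: vec_eq_iff forall_2 integral_affine mu1_affine a_def b_def field_simps)
  then have "Gamma1 s = 0"
    unfolding s_def Gamma1_diff[OF r affine_L2] by simp
  then have "L2_inner s s = 0"
    using orth[OF s] L2_inner_affine[OF s, of a b] L2_inner_diff[OF r affine_L2 s, of a b]
    by (simp add: s_def[symmetric] del: Gamma1_nth)
  then have "AE x in I01. s x = 0" by (rule L2_self_orthogonal[OF s])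
  then have "AE x in I01. r x = affine_fun a b x" by eventually_elim (simp add: s_def)
  then show thesis by (rule that)
qed

section \<open>Solutions of the oscillator equation and their integrals\<close>

definition trig :: "real \<Rightarrow> complex^2 \<Rightarrow> real \<Rightarrow> complex" where
  "trig l c x = c $ 1 * of_real (cos (l * x)) + c $ 2 * of_real (sin (l * x))"

lemma cos_vector_derivative [derivative_intros]:
  "((\<lambda>x. of_real (cos (l * x)) :: complex) has_vector_derivative - of_real (l * sin (l * x))) (at x within S)"
  by (rule has_vector_derivative_eq_rhs, rule has_vector_derivative_of_real,
     rule has_field_derivative_at_within)
    (auto intro!: derivative_eq_intros)

lemma sin_vector_derivative [derivative_intros]:
  "((\<lambda>x. of_real (sin (l * x)) :: complex) has_vector_derivative of_real (l * cos (l * x))) (at x within S)"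
  by (rule has_vector_derivative_eq_rhs, rule has_vector_derivative_of_real,
     rule has_field_derivative_at_within)
    (auto intro!: derivative_eq_intros)

text \<open>The flow rotates the vector \<open>(f, g / l)\<close> by an angle proportional to
  \<open>x\<close>. Undoing the rotation gives constants \<open>u\<close> and \<open>v\<close>, the
  coefficients sought; rotating back recovers \<open>f\<close>.\<close>

lemma harmonic_oscillator:
  fixes f g :: "real \<Rightarrow> complex"
  assumes l: "l \<noteq> 0"
    and f: "\<And>x. x \<in> {0..1} \<Longrightarrow> (f has_vector_derivative g x) (at x within {0..1})"
    and g: "\<And>x. x \<in> {0..1} \<Longrightarrow> (g has_vector_derivative - of_real (l\<^sup>2) * f x) (at x within {0..1})"
  obtains c where "\<And>x. x \<in> {0..1} \<Longrightarrow> f x = trig l c x"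
proof -
  let ?C = "\<lambda>x. of_real (cos (l * x)) :: complex" and ?S = "\<lambda>x. of_real (sin (l * x)) :: complex"
  define u where "u = (\<lambda>x. f x * ?C x - g x * ?S x / of_real l)"
  define v where "v = (\<lambda>x. f x * ?S x + g x * ?C x / of_real l)"
  have "(u has_vector_derivative 0) (at x within {0..1})" if "x \<in> {0..1}" for x
    unfolding u_def
    by (rule has_vector_derivative_eq_rhs, (rule derivative_eq_intros f g that refl)+)
      (use l in \<open>simp add: field_simps power2_eq_square\<close>)
  then obtain c1 where c1: "\<And>x. x \<in> {0..1} \<Longrightarrow> u x = c1"
    using has_vector_derivative_zero_constant[of "{0..1}" u] by auto
  have "(v has_vector_derivative 0) (at x within {0..1})" if "x \<in> {0..1}" for x
    unfolding v_def
    by (rule has_vector_derivative_eq_rhs, (rule derivative_eq_intros f g that refl)+)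
      (use l in \<open>simp add: field_simps power2_eq_square\<close>)
  then obtain c2 where c2: "\<And>x. x \<in> {0..1} \<Longrightarrow> v x = c2"
    using has_vector_derivative_zero_constant[of "{0..1}" v] by auto
  have "f x = trig l (vector [c1, c2]) x" if "x \<in> {0..1}" for x
  proof -
    have CS: "?C x * ?C x + ?S x * ?S x = 1"
      by (simp only: of_real_mult[symmetric] of_real_add[symmetric] sin_cos_squared_add3 of_real_1)
    have "trig l (vector [c1, c2]) x = u x * ?C x + v x * ?S x"
      by (simp add: trig_def c1[OF that] c2[OF that])
    also have "\<dots> = f x * (?C x * ?C x + ?S x * ?S x)"
      by (simp add: u_def v_def algebra_simps)
    finally show ?thesis using CS by simp
  qed
  then show thesis by (rule that)
qed

lemma of_real_vector_derivative [derivative_intros]: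
  "((\<lambda>x. of_real x :: complex) has_vector_derivative 1) (at x within S)"
  by (rule has_vector_derivative_eq_rhs[OF has_vector_derivative_of_real[OF DERIV_ident]]) simp

lemma trig_continuous: "continuous_on S (trig l c)"
  unfolding trig_def[abs_def] by (intro continuous_intros)

lemma trig_L2: "trig l c \<in> L2"
  by (intro L2_continuous trig_continuous)

lemma head_integral_trig:
  assumes l: "l \<noteq> 0" and x: "x \<in> {0..1}"
  shows "head_integral (trig l c) x =
    (c $ 1 * of_real (sin (l * x)) + c $ 2 * (1 - of_real (cos (l * x)))) / of_real l"
proof -
  define F where "F = (\<lambda>x::real.
    (c $ 1 * of_real (sin (l * x)) + c $ 2 * (1 - of_real (cos (l * x)))) / of_real l :: complex)"
  have "(F has_vector_derivative trig l c x) (at x)" for x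
    unfolding F_def trig_def
    by (rule has_vector_derivative_eq_rhs, (rule derivative_eq_intros refl)+)
      (use l in \<open>simp add: field_simps\<close>)
  then have "head_integral (trig l c) x = F x - F 0"
    unfolding head_integral_def using x
    by (intro set_integral_I01_FTC L2_integrable trig_L2) auto
  then show ?thesis by (simp add: F_def)
qed

text \<open>As \<open>mu1\<close> is the mean of the primitive, a second elementary integration
  suffices; \<open>T\<close> is the primitive of \<open>trig l c\<close> and \<open>F\<close> a
  primitive of \<open>T\<close>.\<close>

lemma mu1_trig:
  assumes l: "l \<noteq> 0"
  shows "mu1 (trig l c) =
    (c $ 1 * of_real (1 - cos l) + c $ 2 * of_real (l - sin l)) / of_real (l\<^sup>2)"
proof -
  define T where "T = (\<lambda>x::real.
    (c $ 1 * of_real (sin (l * x)) + c $ 2 * (1 - of_real (cos (l * x)))) / of_real l :: complex)"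
  define F where "F = (\<lambda>x::real.
    (c $ 1 * (- of_real (cos (l * x))) / of_real l
      + c $ 2 * (of_real x - of_real (sin (l * x)) / of_real l)) / of_real l :: complex)"
  have F: "(F has_vector_derivative T x) (at x)" for x
    unfolding F_def T_def
    by (rule has_vector_derivative_eq_rhs, (rule derivative_eq_intros refl)+)
      (use l in \<open>simp add: field_simps\<close>)
  have T: "T \<in> L2"
    by (rule L2_continuous) (use l in \<open>auto simp: T_def intro!: continuous_intros\<close>)
  have "mu1 (trig l c) = (LINT x|I01. T x)"
    unfolding integral_head_integral[OF trig_L2, symmetric]
    by (rule Bochner_Integration.integral_cong) (auto simp: T_def head_integral_trig[OF l])
  also have "\<dots> = F 1 - F 0"
    unfolding integral_I01_eq_head_integral head_integral_def
    by (intro set_integral_I01_FTC L2_integrable T F) auto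
  also have "\<dots> = (c $ 1 * of_real (1 - cos l) + c $ 2 * of_real (l - sin l)) / of_real (l\<^sup>2)"
    using l by (simp add: F_def field_simps power2_eq_square)
  finally show ?thesis .
qed

lemma Gamma1_trig:
  assumes l: "l \<noteq> 0"
  shows "Gamma1 (trig l c) = (matM l ** matB l) *v c"
  using l
  by (simp add: vec_eq_iff forall_2 mu1_trig integral_I01_eq_head_integral head_integral_trig
      matM_def matB_def matrix_matrix_mult_def matrix_vector_mult_def sum_2)
    (simp add: algebra_simps add_divide_distrib diff_divide_distrib)

text \<open>Two integrations reproduce \<open>trig\<close> up to the factor
  \<open>l\<^sup>2\<close>, a sign and an affine term. The tail integral vanishes at 1, and at 0 by
  mean zero, so the affine remainder has the endpoint values of \<open>trig l c\<close>. The proof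
  checks this with explicit primitives.\<close>

lemma tail_integral_mean_zero_head_trig:
  assumes l: "l \<noteq> 0" and x: "x \<in> {0..1}"
  shows "trig l c x - of_real (l\<^sup>2) * tail_integral (mean_zero_head (trig l c)) x =
    affine_fun (trig l c 1) (trig l c 0 - trig l c 1) x"
proof -
  let ?m = "mu1 (trig l c)"
  define T where "T = (\<lambda>x::real.
    (c $ 1 * of_real (sin (l * x)) + c $ 2 * (1 - of_real (cos (l * x)))) / of_real l - ?m :: complex)"
  define F where "F = (\<lambda>x::real. (c $ 1 * (- of_real (cos (l * x))) / of_real l
    + c $ 2 * (of_real x - of_real (sin (l * x)) / of_real l)) / of_real l - ?m * of_real x :: complex)"
  have F: "(F has_vector_derivative T x) (at x)" for x
    unfolding F_def T_def
    by (rule has_vector_derivative_eq_rhs, (rule derivative_eq_intros refl)+)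
      (use l in \<open>simp add: field_simps\<close>)
  have T: "T \<in> L2"
    by (rule L2_continuous) (use l in \<open>auto simp: T_def intro!: continuous_intros\<close>)
  have "tail_integral (mean_zero_head (trig l c)) x = (LINT t:{x..1}|I01. T t)"
    unfolding tail_integral_def set_lebesgue_integral_def
    by (rule Bochner_Integration.integral_cong)
      (auto simp: T_def mean_zero_head_def head_integral_trig[OF l])
  also have "\<dots> = F 1 - F x"
    using x by (intro set_integral_I01_FTC L2_integrable T F) auto
  finally have tail: "tail_integral (mean_zero_head (trig l c)) x = F 1 - F x" .
  show ?thesis
    unfolding tail using l by (simp add: F_def mu1_trig[OF l] trig_def affine_fun_def field_simps power2_eq_square)
qed

lemma has_vector_derivative_zero_on_open:
  fixes F :: "real \<Rightarrow> complex"
  assumes "\<And>x. x \<in> S \<Longrightarrow> (F has_vector_derivative F' x) (at x)"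
    and "open S" "\<And>x. x \<in> S \<Longrightarrow> F x = 0" "x \<in> S"
  shows "F' x = 0"
proof -
  have "((\<lambda>_. 0) has_vector_derivative F' x) (at x)"
    by (rule has_vector_derivative_transform_within_open[OF assms(1)[OF assms(4)] assms(2,4,3)])
  then show ?thesis
    by (rule vector_derivative_unique_at[OF _ has_vector_derivative_const])
qed

text \<open>Ensures that nonzero coefficients give a genuine eigenvector. The primitive vanishes
  everywhere, and differentiating it twice shows that \<open>trig l c\<close> and its derivative
  vanish at each interior point; at one such point this determines \<open>c\<close>.\<close>

lemma trig_AE_zero:
  assumes l: "l \<noteq> 0" and 0: "AE x in I01. trig l c x = 0"
  shows "c = 0"
proof -
  define S where "S = {0<..<1::real}"
  define F where "F = (\<lambda>x::real.
    (c $ 1 * of_real (sin (l * x)) + c $ 2 * (1 - of_real (cos (l * x)))) / of_real l :: complex)"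
  define g where "g = (\<lambda>x::real.
    of_real l * (c $ 2 * of_real (cos (l * x)) - c $ 1 * of_real (sin (l * x))) :: complex)"
  have "head_integral (trig l c) = head_integral (\<lambda>_. 0)"
    using 0 by (intro head_integral_cong_AE trig_L2 L2_const)
  then have head: "head_integral (trig l c) x = 0" for x
    by (simp add: head_integral_def)
  have F0: "F x = 0" if "x \<in> S" for x
    using head[of x] that by (simp add: head_integral_trig[OF l] F_def S_def)
  have t0: "trig l c x = 0" if "x \<in> S" for x
  proof (rule has_vector_derivative_zero_on_open[OF _ _ F0 that])
    show "(F has_vector_derivative trig l c x) (at x)" for x
      unfolding F_def trig_def
      by (rule has_vector_derivative_eq_rhs, (rule derivative_eq_intros refl)+)
        (use l in \<open>simp add: field_simps\<close>)
  qed (simp_all add: S_def)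
  have g0: "g x = 0" if "x \<in> S" for x
  proof (rule has_vector_derivative_zero_on_open[OF _ _ t0 that])
    show "(trig l c has_vector_derivative g x) (at x)" for x
      unfolding g_def trig_def[abs_def]
      by (rule has_vector_derivative_eq_rhs, (rule derivative_eq_intros refl)+)
        (simp add: field_simps)
  qed (simp_all add: S_def)
  define C where "C = (of_real (cos (l * (1/2))) :: complex)"
  define D where "D = (of_real (sin (l * (1/2))) :: complex)"
  have CD: "C * C + D * D = 1"
    unfolding C_def D_def
    by (simp only: of_real_mult[symmetric] of_real_add[symmetric] sin_cos_squared_add3 of_real_1)
  have 1: "c $ 1 * C + c $ 2 * D = 0" and 2: "c $ 2 * C - c $ 1 * D = 0"
    using t0[of "1/2"] g0[of "1/2"] l by (simp_all add: S_def trig_def g_def C_def D_def)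
  \<comment> \<open>The two equations say that a rotation maps \<open>c\<close> to zero; these
    identities apply the inverse rotation.\<close>
  have "c $ 1 = (c $ 1 * C + c $ 2 * D) * C - (c $ 2 * C - c $ 1 * D) * D"
    "c $ 2 = (c $ 1 * C + c $ 2 * D) * D + (c $ 2 * C - c $ 1 * D) * C"
    using CD by algebra+
  then show "c = 0" unfolding 1 2 by (simp add: vec_eq_iff forall_2)
qed

text \<open>Regularity bootstrap: the equation expresses \<open>f\<close> through integrals, so a
  representative \<open>g\<close> is continuous, then differentiable, and differentiating twice
  removes the affine term and leaves the oscillator equation.\<close>

lemma tail_head_equation_trig:
  assumes l: "l \<noteq> 0" and f: "f \<in> L2"
    and eq: "AE x in I01. f x - of_real (l\<^sup>2) * tail_integral (mean_zero_head f) x = affine_fun a b x"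
  obtains c where "AE x in I01. f x = trig l c x"
proof -
  let ?p = "mean_zero_head f"
  define g where "g = (\<lambda>x. of_real (l\<^sup>2) * tail_integral ?p x + affine_fun a b x)"
  have g: "g \<in> L2" unfolding g_def
    by (intro L2_add L2_scale tail_integral_L2 mean_zero_head_L2 f affine_L2)
  have fg: "AE x in I01. f x = g x"
    using eq by eventually_elim (simp add: g_def algebra_simps)
  \<comment> \<open>This closes the loop: \<open>g\<close> is defined from \<open>?p\<close>, and
    \<open>?p\<close> is in turn the normalised primitive of \<open>g\<close>.\<close>
  have pg: "?p = mean_zero_head g" by (rule mean_zero_head_cong_AE[OF f g fg])
  note p = mean_zero_head_L2[OF f]
  \<comment> \<open>Mean zero of \<open>?p\<close> trades the varying lower limit for a varying
    upper limit, which can be differentiated directly.\<close>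
  have tail: "tail_integral ?p x = - integral {0..x} ?p" if "x \<in> {0..1}" for x
    using set_integral_I01_split[OF L2_integrable[OF p] that] integral_mean_zero_head[OF f]
      set_integral_I01(2)[OF L2_integrable[OF p], of 0 x] that
    by (simp add: head_integral_def add_eq_0_iff)
  have head: "?p x = integral {0..x} g - mu1 g" if "x \<in> {0..1}" for x
    using set_integral_I01(2)[OF L2_integrable[OF g], of 0 x] that
    by (simp add: pg mean_zero_head_def head_integral_def)
  have cont: "continuous_on {0..1} (\<lambda>x. integral {0..x} h)" if "h \<in> L2" for h :: "real \<Rightarrow> complex"
    using that by (intro indefinite_integral_continuous_1 set_integral_I01 L2_integrable) auto
  have "continuous_on {0..1} (\<lambda>x. of_real (l\<^sup>2) * (- integral {0..x} ?p) + affine_fun a b x)"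
    unfolding affine_fun_def by (intro continuous_intros cont p)
  then have cg: "continuous_on {0..1} g"
    by (rule continuous_on_eq) (simp add: g_def tail)
  have "continuous_on {0..1} (\<lambda>x. integral {0..x} g - mu1 g)"
    by (intro continuous_intros cont g)
  then have cp: "continuous_on {0..1} ?p"
    by (rule continuous_on_eq) (simp add: head)
  define q where "q = (\<lambda>x. - of_real (l\<^sup>2) * ?p x - b)"
  have 1: "(g has_vector_derivative q x) (at x within {0..1})" if "x \<in> {0..1}" for x
  proof (rule has_vector_derivative_transform[OF that])
    show "((\<lambda>x. of_real (l\<^sup>2) * (- integral {0..x} ?p) + (a + b * (1 - of_real x)))
        has_vector_derivative q x) (at x within {0..1})"
      unfolding q_def
      by (rule has_vector_derivative_eq_rhs,
          (rule derivative_eq_intros refl integral_has_vector_derivative[OF cp that])+) simp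
  qed (simp add: g_def tail affine_fun_def)
  have 2: "(q has_vector_derivative - of_real (l\<^sup>2) * g x) (at x within {0..1})"
    if "x \<in> {0..1}" for x
  proof (rule has_vector_derivative_transform[OF that])
    show "((\<lambda>x. - of_real (l\<^sup>2) * (integral {0..x} g - mu1 g) - b)
        has_vector_derivative - of_real (l\<^sup>2) * g x) (at x within {0..1})"
      by (rule has_vector_derivative_eq_rhs,
          (rule derivative_eq_intros refl integral_has_vector_derivative[OF cg that])+) simp
  qed (simp add: q_def head)
  obtain c where c: "\<And>x. x \<in> {0..1} \<Longrightarrow> g x = trig l c x"
    using harmonic_oscillator[OF l 1 2] by blast
  have "AE x in I01. f x = trig l c x"
    using fg AE_space by eventually_elim (simp add: c)
  then show thesis by (rule that)
qed

section \<open>The eigenvalue equation and its reduction to the coefficient vector\<close>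

definition eigen_residual :: "complex \<Rightarrow> (real \<Rightarrow> complex) \<Rightarrow> real \<Rightarrow> complex" where
  "eigen_residual z f x = f x - z * tail_integral (mean_zero_head f) x"

lemma eigen_residual_L2: "f \<in> L2 \<Longrightarrow> eigen_residual z f \<in> L2"
  unfolding eigen_residual_def[abs_def]
  by (intro L2_diff L2_scale tail_integral_L2 mean_zero_head_L2)

text \<open>By \<open>Hm1_inner_Hm1_of\<close> the form equation splits into an L2 pairing with the
  residual and a pairing of boundary vectors; the product of means in the dual inner product
  accounts for the subtracted vector.\<close>

lemma op_A_eigenvector_iff:
  assumes f: "f \<in> L2"
  shows "(f, Hm1_scale z (Hm1_of f)) \<in> op_A Y K \<longleftrightarrow> Gamma1 f \<in> Y \<and>
    (\<forall>h\<in>V Y. L2_inner (eigen_residual z f) h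
      + cinner2 (K *v Gamma1 f - vector [z * Gamma1 f $ 1, 0]) (Gamma1 h) = 0)"
proof -
  note zf = L2_scale[OF f, of z]
  \<comment> \<open>For the two exceptional \<open>Y\<close> the condition
    \<open>Gamma1 f \<in> Y\<close> already forces mean zero, so membership in \<open>HY Y\<close>
    is automatic.\<close>
  have HY: "Hm1_of (\<lambda>x. z * f x) \<in> HY Y" if "Gamma1 f \<in> Y"
  proof -
    have "Gamma1 f $ 1 = 0" if "Y = {0} \<or> Y = {v. v $ 1 = 0}"
      using that \<open>Gamma1 f \<in> Y\<close> by (auto simp del: Gamma1_nth)
    then show ?thesis
      using Hm1_of_Hm1T[OF zf] by (auto simp: HY_def mu0_Hm1_of)
  qed
  have "form_a K f h = Hm1_inner (Hm1_of (\<lambda>x. z * f x)) (Hm1_of h) \<longleftrightarrow>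
      L2_inner (eigen_residual z f) h
      + cinner2 (K *v Gamma1 f - vector [z * Gamma1 f $ 1, 0]) (Gamma1 h) = 0"
    if h: "h \<in> L2" for h
  proof -
    have t: "tail_integral (mean_zero_head f) \<in> L2"
      by (intro tail_integral_L2 mean_zero_head_L2 f)
    have a: "Hm1_inner (Hm1_of (\<lambda>x. z * f x)) (Hm1_of h) =
        z * L2_inner (tail_integral (mean_zero_head f)) h + z * Gamma1 f $ 1 * cnj (Gamma1 h $ 1)"
      using L2_inner_scale[of z]
      by (simp add: Hm1_inner_Hm1_of[OF zf h] mean_zero_head_scale tail_integral_scale)
    have b: "L2_inner (eigen_residual z f) h =
        L2_inner f h - z * L2_inner (tail_integral (mean_zero_head f)) h"
      using L2_inner_diff[OF f L2_scale[OF t, of z] h] L2_inner_scale[of z]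
      by (simp add: eigen_residual_def[abs_def])
    have c: "cinner2 (K *v Gamma1 f - vector [z * Gamma1 f $ 1, 0]) (Gamma1 h) =
        cinner2 (K *v Gamma1 f) (Gamma1 h) - z * Gamma1 f $ 1 * cnj (Gamma1 h $ 1)"
      by (simp add: cinner2_simps cinner2_2[of "vector _"] del: Gamma1_nth)
    show ?thesis
      unfolding form_a_def a b c
      by (subst eq_iff_diff_eq_0) (simp add: algebra_simps del: Gamma1_nth)
  qed
  then show ?thesis
    using HY f unfolding op_A_def Hm1_scale_Hm1_of V_def by (auto simp del: Gamma1_nth)
qed

lemma eigenvector_cong_AE:
  assumes f: "f \<in> L2" and g: "g \<in> L2" and eq: "AE x in I01. f x = g x"
  shows "(f, Hm1_scale z (Hm1_of f)) \<in> op_A Y K \<longleftrightarrow> (g, Hm1_scale z (Hm1_of g)) \<in> op_A Y K"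
proof -
  have "AE x in I01. eigen_residual z f x = eigen_residual z g x"
    using eq by eventually_elim (simp add: eigen_residual_def mean_zero_head_cong_AE[OF f g eq])
  then have "L2_inner (eigen_residual z f) h = L2_inner (eigen_residual z g) h" if "h \<in> L2" for h
    using f g that by (intro L2_inner_cong_AE eigen_residual_L2)
  then show ?thesis
    unfolding op_A_eigenvector_iff[OF f] op_A_eigenvector_iff[OF g] Gamma1_cong_AE[OF f g eq]
    by (auto simp: V_def)
qed

text \<open>\<open>Gamma1\<close> maps \<open>V Y\<close> onto \<open>Y\<close>, because it is onto
  as a map from L2.\<close>

lemma orthogonal_Gamma1_V_iff: "(\<forall>h\<in>V Y. cinner2 w (Gamma1 h) = 0) \<longleftrightarrow> w \<in> orth_compl Y"
proof
  assume *: "\<forall>h\<in>V Y. cinner2 w (Gamma1 h) = 0"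
  have "cinner2 w y = 0" if "y \<in> Y" for y
  proof -
    obtain h where "h \<in> L2" "Gamma1 h = y" by (rule Gamma1_surj)
    with * that show ?thesis by (auto simp: V_def)
  qed
  then show "w \<in> orth_compl Y" by (simp add: orth_compl_def)
qed (simp add: V_def orth_compl_def)

text \<open>The residual of \<open>trig l c\<close> is affine, so the whole equation depends on
  \<open>h\<close> only through \<open>Gamma1 h\<close> and becomes an orthogonality relation in two
  dimensions.\<close>

lemma trig_eigenvector_iff:
  assumes l: "l \<noteq> 0"
  shows "(trig l c, Hm1_scale (of_real (l\<^sup>2)) (Hm1_of (trig l c))) \<in> op_A Y K \<longleftrightarrow>
    (matM l ** matB l) *v c \<in> Y \<and> (K ** matM l ** matB l - matC l) *v c \<in> orth_compl Y"
proof -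
  let ?f = "trig l c" and ?z = "of_real (l\<^sup>2) :: complex"
  \<comment> \<open>Origin of \<open>matC\<close>: the coefficients of the affine residual,
    corrected by the mean term, are minus \<open>matC l *v c\<close>.\<close>
  have C: "vector [?f 1 - ?z * Gamma1 ?f $ 1, ?f 0 - ?f 1] = - (matC l *v c)"
  proof -
    have "?z * Gamma1 ?f $ 1 =
        of_real l * (c $ 1 * of_real (sin l) + c $ 2 * (1 - of_real (cos l)))"
      using l by (simp add: integral_I01_eq_head_integral head_integral_trig power2_eq_square)
    then show ?thesis
      by (simp add: vec_eq_iff forall_2 matC_def matrix_vector_mult_def sum_2 trig_def
          algebra_simps del: Gamma1_nth)
  qed
  have "(K ** matM l ** matB l - matC l) *v c = K *v Gamma1 ?f - matC l *v c"
    by (simp only: Gamma1_trig[OF l] matrix_vector_mult_diff_rdistrib matrix_vector_mul_assoc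
        matrix_mul_assoc)
  also have "\<dots> = K *v Gamma1 ?f + vector [?f 1 - ?z * Gamma1 ?f $ 1, ?f 0 - ?f 1]"
    unfolding C by simp
  finally have W: "(K ** matM l ** matB l - matC l) *v c =
    K *v Gamma1 ?f + vector [?f 1 - ?z * Gamma1 ?f $ 1, ?f 0 - ?f 1]" .
  have "L2_inner (eigen_residual ?z ?f) h
      + cinner2 (K *v Gamma1 ?f - vector [?z * Gamma1 ?f $ 1, 0]) (Gamma1 h)
      = cinner2 ((K ** matM l ** matB l - matC l) *v c) (Gamma1 h)" if h: "h \<in> L2" for h
  proof -
    have "L2_inner (eigen_residual ?z ?f) h = L2_inner (affine_fun (?f 1) (?f 0 - ?f 1)) h"
      unfolding L2_inner_def eigen_residual_def
      by (rule Bochner_Integration.integral_cong)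
        (auto simp: tail_integral_mean_zero_head_trig[OF l] simp del: of_real_power)
    then show ?thesis
      unfolding L2_inner_affine[OF h] W
      by (simp add: cinner2_2 algebra_simps del: Gamma1_nth)
  qed
  then have "(\<forall>h\<in>V Y. L2_inner (eigen_residual ?z ?f) h
      + cinner2 (K *v Gamma1 ?f - vector [?z * Gamma1 ?f $ 1, 0]) (Gamma1 h) = 0) \<longleftrightarrow>
      (\<forall>h\<in>V Y. cinner2 ((K ** matM l ** matB l - matC l) *v c) (Gamma1 h) = 0)"
    by (simp add: V_def)
  also have "\<dots> \<longleftrightarrow> (K ** matM l ** matB l - matC l) *v c \<in> orth_compl Y"
    by (rule orthogonal_Gamma1_V_iff)
  finally show ?thesis
    unfolding op_A_eigenvector_iff[OF trig_L2] Gamma1_trig[OF l] by blast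
qed

text \<open>Test functions with \<open>Gamma1 h = 0\<close> belong to \<open>V Y\<close> for every
  subspace and kill the boundary term, so the residual is orthogonal to that kernel and hence
  affine.\<close>

lemma eigenvector_is_trig:
  assumes l: "l \<noteq> 0" and Y: "vec.subspace Y" and f: "f \<in> L2"
    and eig: "(f, Hm1_scale (of_real (l\<^sup>2)) (Hm1_of f)) \<in> op_A Y K"
  obtains c where "AE x in I01. f x = trig l c x"
proof -
  have "L2_inner (eigen_residual (of_real (l\<^sup>2)) f) h = 0" if "h \<in> L2" "Gamma1 h = 0" for h
  proof -
    have "h \<in> V Y" using that vec.subspace_0[OF Y] by (simp add: V_def)
    then show ?thesis
      using eig that(2) unfolding op_A_eigenvector_iff[OF f] by (auto simp: cinner2_2[of _ 0])
  qed
  then obtain a b where "AE x in I01. eigen_residual (of_real (l\<^sup>2)) f x = affine_fun a b x"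
    using orthogonal_to_Gamma1_kernel[OF eigen_residual_L2[OF f]] by blast
  then show thesis
    using tail_head_equation_trig[OF l f] that unfolding eigen_residual_def by blast
qed

theorem theorem4p5:
  fixes K :: "complex^2^2" and Y :: "(complex^2) set" and l :: real
  assumes "hermitian2 K"
    and "vec.subspace Y"
    and "l \<noteq> 0"
  shows "is_eigenvalue (op_A Y K) (of_real (l\<^sup>2)) \<longleftrightarrow>
    rank (stack (orth_proj (orth_compl Y) ** matM l ** matB l)
                (orth_proj Y ** (K ** matM l ** matB l - matC l))) \<in> {0, 1}"
proof -
  note Y = assms(2) and l = assms(3)
  let ?z = "of_real (l\<^sup>2) :: complex"
  let ?E = "\<lambda>f. (f, Hm1_scale ?z (Hm1_of f)) \<in> op_A Y K"
  let ?S = "stack (orth_proj (orth_compl Y) ** matM l ** matB l)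
                (orth_proj Y ** (K ** matM l ** matB l - matC l))"
  have "?S *v c = 0 \<longleftrightarrow> orth_proj (orth_compl Y) *v ((matM l ** matB l) *v c) = 0 \<and>
      orth_proj Y *v ((K ** matM l ** matB l - matC l) *v c) = 0" for c
    by (simp only: stack_mult_eq_0_iff matrix_vector_mul_assoc matrix_mul_assoc)
  \<comment> \<open>The upper block annihilates \<open>c\<close> exactly when
    \<open>(matM l ** matB l) *v c\<close> lies in the double complement of \<open>Y\<close>, which
    is \<open>Y\<close>. The two blocks thus encode the two conditions of
    \<open>trig_eigenvector_iff\<close>.\<close>
  then have S: "?S *v c = 0 \<longleftrightarrow> ?E (trig l c)" for c
    unfolding trig_eigenvector_iff[OF l] orth_proj_eq_0_iff[OF Y]
      orth_proj_eq_0_iff[OF subspace_orth_compl] orth_compl_orth_compl[OF Y] .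
  have "is_eigenvalue (op_A Y K) ?z \<longleftrightarrow> (\<exists>c. c \<noteq> 0 \<and> ?S *v c = 0)"
  proof
    assume "is_eigenvalue (op_A Y K) ?z"
    then obtain f where nz: "\<not> (AE x in I01. f x = 0)" and E: "?E f"
      unfolding is_eigenvalue_def by blast
    then have f: "f \<in> L2" by (simp add: op_A_def V_def)
    obtain c where c: "AE x in I01. f x = trig l c x" using eigenvector_is_trig[OF l Y f E] .
    have "c \<noteq> 0" using nz c by (auto simp: trig_def)
    \<comment> \<open>The eigenvector is known only almost everywhere, so the property is
      transferred to its trigonometric representative.\<close>
    moreover have "?E (trig l c)" using E eigenvector_cong_AE[OF f trig_L2 c] by blast
    ultimately show "\<exists>c. c \<noteq> 0 \<and> ?S *v c = 0" using S by blast
  next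
    assume "\<exists>c. c \<noteq> 0 \<and> ?S *v c = 0"
    then show "is_eigenvalue (op_A Y K) ?z"
      unfolding is_eigenvalue_def S using trig_AE_zero[OF l] by blast
  qed
  also have "\<dots> \<longleftrightarrow> rank ?S < 2"
    using exists_kernel_vector_iff_rank[of ?S] by simp
  also have "\<dots> \<longleftrightarrow> rank ?S \<in> {0, 1}" by auto
  finally show ?thesis .
qed

end
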